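(* Let $(M,g)=(B\times_f F,\ g_B+f^2g_F)$ be a warped product manifold, let $(\overline{M},\overline{g})=G_2(\mathbb{C}^{k+2})=SU_{k+2}/S(U_kU_2)$ be the complex two-plane Grassmannian, and let $\psi:(M,g)\to(\overline{M},\overline{g})$ be an isometric immersion. Let $m_1=\dim B$, $m_2=\dim F$ and $m=m_1+m_2$. Then $$\frac{m_1 m^2}{2(m-1)}H^2-\frac{m_1}{2}\|h\|^2-m_1\ \le\ \frac{\triangle f}{f}\ \le\ \frac{m^2}{4m_2}H^2+8m_1 .$$
   Context: $(B,g_B)$ and $(F,g_F)$ are Riemannian manifolds (of positive dimension), $f:B\to\mathbb{R}^+$ is a smooth positive function (the warping function), and $B\times_f F$ is the product $B\times F$ with the metric $g=g_B+f^2g_F$; $f$ is also regarded as a function on $M$ via the projection to $B$. The Laplacian is $\triangle f=\sum_{i=1}^m\big((\nabla_{v_i}v_i)f-v_i^2f\big)$ for a local orthonormal frame $v_1,\dots,v_m$ of $TM$, where $\nabla$ is the Levi-Civita connection of $M$ (note the sign). $h$ is the second fundamental form of $M$ in $\overline{M}$, the mean curvature vector is $H=\frac1m\sum_{i=1}^m h(v_i,v_i)$, $H^2=\overline{g}(H,H)$, and $\|h\|^2=\sum_{i,j=1}^m\overline{g}(h(v_i,v_j),h(v_i,v_j))$. The inequalities are between functions on $M$, at every point. $G_2(\mathbb{C}^{k+2})$ carries its Kähler structure $J$ and its quaternionic Kähler structure, locally spanned by almost Hermitian structures $J_1,J_2,J_3$ satisfying the quaternion relations, with $JJ_\alpha=J_\alpha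 J$. The invariant metric $\overline{g}$ is normalized so that the curvature tensor is $$\overline{R}(X,Y)Z=\overline{g}(Y,Z)X-\overline{g}(X,Z)Y+\overline{g}(JY,Z)JX-\overline{g}(JX,Z)JY-2\overline{g}(JX,Y)JZ$$ $$+\sum_{\alpha=1}^3\big(\overline{g}(J_\alpha Y,Z)J_\alpha X-\overline{g}(J_\alpha X,Z)J_\alpha Y-2\overline{g}(J_\alpha X,Y)J_\alpha Z\big)+\sum_{\alpha=1}^3\big(\overline{g}(J_\alpha JY,Z)J_\alpha JX-\overline{g}(J_\alpha JX,Z)J_\alpha JY\big).$$
   Formalization: The Laplacian of f is taken on the base B, not on M: with the Laplacian of M the left inequality fails (polar coordinates on a totally geodesic flat plane, f = r < 1). The right inequality for M follows, since the Laplacian of f on M is at most the one on B. *)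

theory Defs
  imports "HOL-Analysis.Analysis"
begin

section \<open>Smooth maps between open subsets of Euclidean spaces\<close>

text \<open>All of the following is meant for open sets \<open>S\<close>. By finite dimensionality, being \<open>C\<^sup>k\<^sup>+\<^sup>1\<close>
  amounts to all directional derivatives being \<open>C\<^sup>k\<close>.\<close>

primrec Ck_on :: "nat \<Rightarrow> 'a::euclidean_space set \<Rightarrow> ('a \<Rightarrow> 'b::real_normed_vector) \<Rightarrow> bool" where
  "Ck_on 0 S f \<longleftrightarrow> continuous_on S f"
| "Ck_on (Suc k) S f \<longleftrightarrow> (\<forall>x\<in>S. f differentiable (at x)) \<and>
     (\<forall>v. Ck_on k S (\<lambda>x. frechet_derivative f (at x) v))"

definition smooth_on :: "'a::euclidean_space set \<Rightarrow> ('a \<Rightarrow> 'b::real_normed_vector) \<Rightarrow> bool" where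
  "smooth_on S f \<longleftrightarrow> (\<forall>k. Ck_on k S f)"


section \<open>Smooth manifolds\<close>

text \<open>A manifold modelled on the Euclidean space \<open>'e\<close> is given by a family of injective
  parametrizations \<open>par M i : dom M i \<rightarrow> 'a\<close> of its coordinate neighbourhoods; its points are the
  union of the images and its topology is the one determined by the parametrizations. The
  dimension is \<open>DIM('e)\<close>, which is positive.\<close>

record ('i, 'e, 'a) manifold =
  indices :: "'i set"
  dom :: "'i \<Rightarrow> 'e set"
  par :: "'i \<Rightarrow> 'e \<Rightarrow> 'a"

hide_const (open) Map.dom

definition carrier :: "('i, 'e, 'a) manifold \<Rightarrow> 'a set" where
  "carrier M = (\<Union>i\<in>indices M. par M i ` dom M i)"

definition manifold_topology :: "('i, 'e::euclidean_space, 'a) manifold \<Rightarrow> 'a topology" where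
  "manifold_topology M = topology (\<lambda>W. W \<subseteq> carrier M \<and>
     (\<forall>i\<in>indices M. open {x \<in> dom M i. par M i x \<in> W}))"

text \<open>The coordinate representation of a map \<open>\<psi>\<close> in the charts \<open>i\<close> and \<open>j\<close>, and the set on
  which it is defined.\<close>

definition rep_dom ::
  "('i, 'e, 'a) manifold \<Rightarrow> ('j, 'd, 'b) manifold \<Rightarrow> ('a \<Rightarrow> 'b) \<Rightarrow> 'i \<Rightarrow> 'j \<Rightarrow> 'e set" where
  "rep_dom M N \<psi> i j = {x \<in> dom M i. \<psi> (par M i x) \<in> par N j ` dom N j}"

definition rep ::
  "('i, 'e, 'a) manifold \<Rightarrow> ('j, 'd, 'b) manifold \<Rightarrow> ('a \<Rightarrow> 'b) \<Rightarrow> 'i \<Rightarrow> 'j \<Rightarrow> 'e \<Rightarrow> 'd" where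
  "rep M N \<psi> i j = (\<lambda>x. inv_into (dom N j) (par N j) (\<psi> (par M i x)))"

definition smooth_map ::
  "('i, 'e::euclidean_space, 'a) manifold \<Rightarrow> ('j, 'd::euclidean_space, 'b) manifold \<Rightarrow>
   ('a \<Rightarrow> 'b) \<Rightarrow> bool" where
  "smooth_map M N \<psi> \<longleftrightarrow> \<psi> ` carrier M \<subseteq> carrier N \<and>
     (\<forall>i\<in>indices M. \<forall>j\<in>indices N.
        open (rep_dom M N \<psi> i j) \<and> smooth_on (rep_dom M N \<psi> i j) (rep M N \<psi> i j))"

definition smooth_fun :: "('i, 'e::euclidean_space, 'a) manifold \<Rightarrow> ('a \<Rightarrow> real) \<Rightarrow> bool" where
  "smooth_fun M f \<longleftrightarrow> (\<forall>i\<in>indices M. smooth_on (dom M i) (\<lambda>x. f (par M i x)))"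

text \<open>\<open>smooth_map M M (\<lambda>p. p)\<close> says that the transition maps are smooth with open domains.\<close>

definition smooth_manifold :: "('i, 'e::euclidean_space, 'a) manifold \<Rightarrow> bool" where
  "smooth_manifold M \<longleftrightarrow>
     (\<forall>i\<in>indices M. open (dom M i) \<and> inj_on (par M i) (dom M i)) \<and>
     smooth_map M M (\<lambda>p. p) \<and>
     Hausdorff_space (manifold_topology M) \<and> second_countable (manifold_topology M)"

definition product_manifold ::
  "('i, 'e, 'a) manifold \<Rightarrow> ('j, 'd, 'b) manifold \<Rightarrow> ('i \<times> 'j, 'e \<times> 'd, 'a \<times> 'b) manifold" where
  "product_manifold B F =
     \<lparr> indices = indices B \<times> indices F,
       dom = (\<lambda>(i, j). dom B i \<times> dom F j),
       par = (\<lambda>(i, j) (x, y). (par B i x, par F j y)) \<rparr>"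


section \<open>Riemannian metrics\<close>

text \<open>A metric is given by its coordinate expressions: \<open>g i x u v\<close> is the inner product, at the
  point with coordinates \<open>x\<close> in chart \<open>i\<close>, of the tangent vectors with components \<open>u\<close> and \<open>v\<close>.\<close>

type_synonym 'e local_metric = "'e \<Rightarrow> 'e \<Rightarrow> 'e \<Rightarrow> real"
type_synonym ('i, 'e) metric_field = "'i \<Rightarrow> 'e local_metric"

definition preserves_metric ::
  "('i, 'e::euclidean_space, 'a) manifold \<Rightarrow> ('i, 'e) metric_field \<Rightarrow>
   ('j, 'd::euclidean_space, 'b) manifold \<Rightarrow> ('j, 'd) metric_field \<Rightarrow> ('a \<Rightarrow> 'b) \<Rightarrow> bool" where
  "preserves_metric M g N h \<psi> \<longleftrightarrow>
     (\<forall>i\<in>indices M. \<forall>j\<in>indices N. \<forall>x\<in>rep_dom M N \<psi> i j. \<forall>u v.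
        g i x u v =
        h j (rep M N \<psi> i j x) (frechet_derivative (rep M N \<psi> i j) (at x) u)
                              (frechet_derivative (rep M N \<psi> i j) (at x) v))"

text \<open>\<open>preserves_metric M g M g (\<lambda>p. p)\<close> is the transformation law under change of charts.\<close>

definition riemannian_metric ::
  "('i, 'e::euclidean_space, 'a) manifold \<Rightarrow> ('i, 'e) metric_field \<Rightarrow> bool" where
  "riemannian_metric M g \<longleftrightarrow>
     (\<forall>i\<in>indices M.
        (\<forall>x\<in>dom M i. bilinear (g i x) \<and> (\<forall>u v. g i x u v = g i x v u) \<and>
           (\<forall>u. u \<noteq> 0 \<longrightarrow> g i x u u > 0)) \<and>
        (\<forall>u v. smooth_on (dom M i) (\<lambda>x. g i x u v))) \<and>
     preserves_metric M g M g (\<lambda>p. p)"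

text \<open>Injectivity of the differential is automatic, as the metric of the source is positive
  definite.\<close>

definition isometric_immersion ::
  "('i, 'e::euclidean_space, 'a) manifold \<Rightarrow> ('i, 'e) metric_field \<Rightarrow>
   ('j, 'd::euclidean_space, 'b) manifold \<Rightarrow> ('j, 'd) metric_field \<Rightarrow> ('a \<Rightarrow> 'b) \<Rightarrow> bool" where
  "isometric_immersion M g N h \<psi> \<longleftrightarrow> smooth_map M N \<psi> \<and> preserves_metric M g N h \<psi>"

definition warped_metric ::
  "('i, 'e, 'a) manifold \<Rightarrow> ('i, 'e) metric_field \<Rightarrow> ('a \<Rightarrow> real) \<Rightarrow> ('j, 'd) metric_field \<Rightarrow>
   ('i \<times> 'j, 'e \<times> 'd) metric_field" where
  "warped_metric B gB f gF = (\<lambda>(i, j) (x, y) (u, w) (u', w').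
     gB i x u u' + (f (par B i x))\<^sup>2 * gF j y w w')"


section \<open>Levi-Civita connection, curvature, Laplacian, second fundamental form\<close>

text \<open>These are written in a chart with local metric \<open>G\<close>; vector fields are functions from
  coordinates to components. The Levi-Civita connection is \<open>\<nabla>\<^sub>u Y = D\<^sub>u Y + \<Gamma>(u, Y)\<close> where
  \<open>\<Gamma>\<close> is symmetric (no torsion) and makes \<open>G\<close> parallel.\<close>

definition christoffel :: "'e::euclidean_space local_metric \<Rightarrow> 'e \<Rightarrow> 'e \<Rightarrow> 'e \<Rightarrow> 'e" where
  "christoffel G x = (THE \<Gamma>. bilinear \<Gamma> \<and> (\<forall>u v. \<Gamma> u v = \<Gamma> v u) \<and>
     (\<forall>u v w. frechet_derivative (\<lambda>y. G y v w) (at x) u = G x (\<Gamma> u v) w + G x v (\<Gamma> u w)))"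

definition covariant_derivative ::
  "'e::euclidean_space local_metric \<Rightarrow> 'e \<Rightarrow> 'e \<Rightarrow> ('e \<Rightarrow> 'e) \<Rightarrow> 'e" where
  "covariant_derivative G x u Y = frechet_derivative Y (at x) u + christoffel G x u (Y x)"

text \<open>\<open>R(u,v)w = \<nabla>\<^sub>u\<nabla>\<^sub>v w - \<nabla>\<^sub>v\<nabla>\<^sub>u w - \<nabla>\<^bsub>[u,v]\<^esub> w\<close>, evaluated on the fields with constant
  components \<open>u\<close>, \<open>v\<close>, \<open>w\<close>, whose brackets vanish.\<close>

definition curvature :: "'e::euclidean_space local_metric \<Rightarrow> 'e \<Rightarrow> 'e \<Rightarrow> 'e \<Rightarrow> 'e \<Rightarrow> 'e" where
  "curvature G x u v w =
     covariant_derivative G x u (\<lambda>y. covariant_derivative G y v (\<lambda>_. w)) -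
     covariant_derivative G x v (\<lambda>y. covariant_derivative G y u (\<lambda>_. w))"

text \<open>Frames are indexed by \<open>Basis\<close>, which has as many elements as the manifold has dimensions.\<close>

definition orthonormal_at :: "'e::euclidean_space local_metric \<Rightarrow> 'e \<Rightarrow> ('e \<Rightarrow> 'e) \<Rightarrow> bool" where
  "orthonormal_at G x e \<longleftrightarrow>
     (\<forall>a\<in>Basis. \<forall>b\<in>Basis. G x (e a) (e b) = (if a = b then 1 else 0))"

definition local_orthonormal_frame ::
  "'e::euclidean_space local_metric \<Rightarrow> 'e set \<Rightarrow> ('e \<Rightarrow> 'e \<Rightarrow> 'e) \<Rightarrow> bool" where
  "local_orthonormal_frame G W V \<longleftrightarrow> open W \<and> (\<forall>b\<in>Basis. smooth_on W (V b)) \<and>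
     (\<forall>x\<in>W. orthonormal_at G x (\<lambda>b. V b x))"

text \<open>The Laplacian of \<open>\<phi>\<close> computed with the frame \<open>V\<close>, with the sign convention
  \<open>\<Delta>\<phi> = \<Sum>\<^sub>b ((\<nabla>\<^bsub>V b\<^esub> V b) \<phi> - V b (V b \<phi>))\<close>. For the warping function \<open>f\<close> it is
  to be taken on the base: the Laplacian of the warped product applied to the pullback of \<open>f\<close>
  has the additional term \<open>- m\<^sub>2 |\<nabla>f|\<^sup>2 / f\<close>, for which the lower bound on \<open>\<Delta>f / f\<close> fails
  (polar coordinates on a totally geodesic flat plane).\<close>

definition laplacian ::
  "'e::euclidean_space local_metric \<Rightarrow> ('e \<Rightarrow> 'e \<Rightarrow> 'e) \<Rightarrow> ('e \<Rightarrow> real) \<Rightarrow> 'e \<Rightarrow> real" where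
  "laplacian G V \<phi> x = (\<Sum>b\<in>Basis.
     frechet_derivative \<phi> (at x) (covariant_derivative G x (V b x) (V b)) -
     frechet_derivative (\<lambda>y. frechet_derivative \<phi> (at y) (V b y)) (at x) (V b x))"

text \<open>Covariant derivative, in the direction \<open>u\<close>, of a field \<open>Z\<close> along the map \<open>\<psi>\<close> with
  respect to the metric \<open>H\<close> of the target.\<close>

definition covariant_derivative_along ::
  "'d::euclidean_space local_metric \<Rightarrow> ('e::euclidean_space \<Rightarrow> 'd) \<Rightarrow> 'e \<Rightarrow> 'e \<Rightarrow> ('e \<Rightarrow> 'd) \<Rightarrow> 'd"
  where
  "covariant_derivative_along H \<psi> x u Z =
     frechet_derivative Z (at x) u +
     christoffel H (\<psi> x) (frechet_derivative \<psi> (at x) u) (Z x)"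

text \<open>Gauss formula \<open>h(u,v) = \<nabla>'\<^sub>u (d\<psi> v) - d\<psi> (\<nabla>\<^sub>u v)\<close>, with \<open>v\<close> extended by constant
  components.\<close>

definition second_fundamental_form ::
  "'e::euclidean_space local_metric \<Rightarrow> 'd::euclidean_space local_metric \<Rightarrow> ('e \<Rightarrow> 'd) \<Rightarrow>
   'e \<Rightarrow> 'e \<Rightarrow> 'e \<Rightarrow> 'd" where
  "second_fundamental_form G H \<psi> x u v =
     covariant_derivative_along H \<psi> x u (\<lambda>y. frechet_derivative \<psi> (at y) v) -
     frechet_derivative \<psi> (at x) (covariant_derivative G x u (\<lambda>_. v))"

definition mean_curvature_vector ::
  "('e::euclidean_space \<Rightarrow> 'e \<Rightarrow> 'd::euclidean_space) \<Rightarrow> ('e \<Rightarrow> 'e) \<Rightarrow> 'd" where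
  "mean_curvature_vector h e = (1 / real DIM('e)) *\<^sub>R (\<Sum>a\<in>Basis. h (e a) (e a))"

text \<open>Squared length with respect to the inner product \<open>q\<close> on the target tangent space.\<close>

definition sff_norm_sq ::
  "('d \<Rightarrow> 'd \<Rightarrow> real) \<Rightarrow> ('e::euclidean_space \<Rightarrow> 'e \<Rightarrow> 'd) \<Rightarrow> ('e \<Rightarrow> 'e) \<Rightarrow> real" where
  "sff_norm_sq q h e = (\<Sum>a\<in>Basis. \<Sum>b\<in>Basis. q (h (e a) (e b)) (h (e a) (e b)))"


section \<open>The complex two-plane Grassmannian\<close>

definition conj_transpose :: "complex^'n^'m \<Rightarrow> complex^'m^'n" where
  "conj_transpose A = (\<chi> i j. cnj (A $ j $ i))"

definition special_unitary :: "(complex^'n^'n) set" where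
  "special_unitary = {A. A ** conj_transpose A = mat 1 \<and> det A = 1}"

text \<open>With \<open>k = CARD('k)\<close>, the points are the complex 2-dimensional subspaces of
  \<open>complex^('k + 2)\<close>. The graph of a linear map from the last two
  coordinates to the first \<open>k\<close> coordinates is such a plane; the charts are the graph charts and
  their translates by \<open>U \<in> SU(k+2)\<close>. Every plane is the centre \<open>Z = 0\<close> of some chart, and the
  stabilizer of \<open>graph_plane 0\<close> is \<open>S(U\<^sub>k U\<^sub>2)\<close>, acting on the coordinates by
  \<open>Z \<mapsto> A Z C\<^sup>-\<^sup>1\<close> for \<open>(A, C)\<close> in \<open>S(U\<^sub>k U\<^sub>2)\<close>.\<close>

definition graph_plane :: "complex^2^'k::finite \<Rightarrow> (complex^('k + 2)) set" where
  "graph_plane Z = {v. \<forall>i. v $ Inl i = (\<Sum>j\<in>UNIV. Z $ i $ j * v $ Inr j)}"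

definition grassmannian ::
  "(complex^('k + 2)^('k + 2), complex^2^'k::finite, (complex^('k + 2)) set) manifold" where
  "grassmannian =
     \<lparr> indices = special_unitary,
       dom = (\<lambda>U. UNIV),
       par = (\<lambda>U Z. (\<lambda>v. U *v v) ` graph_plane Z) \<rparr>"

text \<open>\<open>J\<close> and a canonical basis of the quaternionic structure at the centre \<open>Z = 0\<close> of a chart.
  The quaternionic structure comes from the \<open>su(2)\<close> summand of the isotropy algebra, which acts
  by right multiplication on \<open>Z\<close>. Changing the chart with given centre rotates the basis, so
  that all canonical bases at a point arise in this way.\<close>

definition cpx_J :: "complex^2^'k \<Rightarrow> complex^2^'k" where
  "cpx_J X = (\<chi> i j. \<i> * X $ i $ j)"

definition quat_unit :: "nat \<Rightarrow> complex^2^2" where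
  "quat_unit \<alpha> =
     (if \<alpha> = 1 then vector [vector [\<i>, 0], vector [0, - \<i>]]
      else if \<alpha> = 2 then vector [vector [0, 1], vector [- 1, 0]]
      else vector [vector [0, - \<i>], vector [- \<i>, 0]])"

definition quat_J :: "nat \<Rightarrow> complex^2^'k::finite \<Rightarrow> complex^2^'k" where
  "quat_J \<alpha> X = X ** quat_unit \<alpha>"

lemma quat_relations:
  "quat_J 1 (quat_J 2 X) = quat_J 3 X" "quat_J 2 (quat_J 1 X) = - quat_J 3 X"
  "quat_J 1 (quat_J 1 X) = - X" "quat_J 2 (quat_J 2 X) = - X" "quat_J 3 (quat_J 3 X) = - X"
  "cpx_J (cpx_J X) = - X" "cpx_J (quat_J \<alpha> X) = quat_J \<alpha> (cpx_J X)"
  by (simp_all add: quat_J_def quat_unit_def cpx_J_def vec_eq_iff matrix_matrix_mult_def sum_2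
        forall_2 algebra_simps)

definition grassmannian_curvature ::
  "(complex^2^'k \<Rightarrow> complex^2^'k \<Rightarrow> real) \<Rightarrow>
   complex^2^'k::finite \<Rightarrow> complex^2^'k \<Rightarrow> complex^2^'k \<Rightarrow> complex^2^'k" where
  "grassmannian_curvature q X Y Z =
     q Y Z *\<^sub>R X - q X Z *\<^sub>R Y
     + q (cpx_J Y) Z *\<^sub>R cpx_J X - q (cpx_J X) Z *\<^sub>R cpx_J Y - (2 * q (cpx_J X) Y) *\<^sub>R cpx_J Z
     + (\<Sum>\<alpha>=1..3. q (quat_J \<alpha> Y) Z *\<^sub>R quat_J \<alpha> X - q (quat_J \<alpha> X) Z *\<^sub>R quat_J \<alpha> Y
          - (2 * q (quat_J \<alpha> X) Y) *\<^sub>R quat_J \<alpha> Z)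
     + (\<Sum>\<alpha>=1..3. q (quat_J \<alpha> (cpx_J Y)) Z *\<^sub>R quat_J \<alpha> (cpx_J X)
          - q (quat_J \<alpha> (cpx_J X)) Z *\<^sub>R quat_J \<alpha> (cpx_J Y))"

text \<open>The \<open>SU(k+2)\<close>-invariant metric for which \<open>J\<close> and \<open>J\<^sub>1, J\<^sub>2, J\<^sub>3\<close> are almost Hermitian,
  normalized through its curvature tensor. At \<open>Z = 0\<close> it is the inner product
  \<open>(X, Y) \<mapsto> Re (tr (X\<^sup>* Y)) / 2\<close>.\<close>

definition normalized_grassmannian_metric ::
  "(complex^('k + 2)^('k + 2), complex^2^'k::finite) metric_field \<Rightarrow> bool" where
  "normalized_grassmannian_metric g \<longleftrightarrow>
     riemannian_metric grassmannian g \<and>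
     (\<forall>A\<in>special_unitary. isometric_immersion grassmannian g grassmannian g ((`) (\<lambda>v. A *v v))) \<and>
     (\<forall>U\<in>special_unitary. \<forall>X Y.
        g U 0 (cpx_J X) (cpx_J Y) = g U 0 X Y \<and>
        (\<forall>\<alpha>\<in>{1..3}. g U 0 (quat_J \<alpha> X) (quat_J \<alpha> Y) = g U 0 X Y)) \<and>
     (\<forall>U\<in>special_unitary. \<forall>X Y Z.
        curvature (g U) 0 X Y Z = grassmannian_curvature (g U 0) X Y Z)"

end

theory Submission
  imports Defs
begin

text \<open>A plane spanned by a unit vector \<open>v\<close> of the base and a unit vector of the fibre has sectional
  curvature \<open>- Hess f (v, v) / f\<close> in the warped product, so for every unit fibre vector the sum of
  these curvatures over an orthonormal frame of the base is \<open>\<Delta>f / f\<close>. The Gauss equation expresses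
  each of them through the sectional curvature of the Grassmannian, which lies in \<open>[-1, 8]\<close>, and the
  second fundamental form. Summation over all fibre directions and \<open>\<langle>A, B\<rangle> \<le> |A + B|\<^sup>2 / 4\<close> give the
  upper bound; for a single fibre direction, Chen's inequality
  \<open>2 (\<langle>h\<^sub>b\<^sub>b, h\<^sub>c\<^sub>c\<rangle> - |h\<^sub>b\<^sub>c|\<^sup>2) \<ge> m\<^sup>2 H\<^sup>2 / (m - 1) - |h|\<^sup>2\<close> gives the lower one.\<close>

section \<open>Directional derivatives\<close>

text \<open>All computation takes place in charts, and two definitions resist direct use there.
  \<open>christoffel\<close> is a definite description, so the Koszul formula must first supply its
  value; \<open>curvature\<close> differentiates it, so its dependence on the point must be
  controlled as well, which is done by viewing it as the solution of a linear system with the metric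
  as coefficient matrix. And the metric of the Grassmannian is given only through its curvature at
  the chart centres, whereas the image of \<open>\<psi>\<close> may meet any point of a chart; this
  is why planes must be moved by unitary matrices and curvature compared across transition maps. The
  traces in the statement use an arbitrary frame of M, the estimates one adapted to the product, so
  independence of the frame is needed too. The two bounds differ in shape because averaging over the
  fibre directions puts their number into a denominator, while Chen's inequality holds for each pair
  of directions and needs no averaging.\<close>

abbreviation dir_deriv :: "('a::euclidean_space \<Rightarrow> 'b::real_normed_vector) \<Rightarrow> 'a \<Rightarrow> 'a \<Rightarrow> 'b" where
  "dir_deriv f x u \<equiv> frechet_derivative f (at x) u"

lemma frechet_derivative_eqI:
  "(f has_derivative f') (at x) \<Longrightarrow> frechet_derivative f (at x) = f'"
  by (metis frechet_derivative_at)

lemma smooth_on_differentiable: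
  "smooth_on S f \<Longrightarrow> x \<in> S \<Longrightarrow> f differentiable (at x)"
  by (metis Ck_on.simps(2) smooth_on_def)

lemma smooth_on_dir_deriv:
  "smooth_on S f \<Longrightarrow> smooth_on S (\<lambda>x. dir_deriv f x v)"
  by (metis Ck_on.simps(2) smooth_on_def)

lemma smooth_on_continuous: "smooth_on S f \<Longrightarrow> continuous_on S f"
  by (metis Ck_on.simps(1) smooth_on_def)

section \<open>Symmetry of second derivatives\<close>

lemma mixed_difference:
  fixes f :: "'a::euclidean_space \<Rightarrow> real"
  assumes f: "\<And>s t. \<lbrakk>0 \<le> s; s \<le> r; 0 \<le> t; t \<le> r\<rbrakk> \<Longrightarrow> f differentiable (at (x + s *\<^sub>R u + t *\<^sub>R v))"
    and Df: "\<And>s t. \<lbrakk>0 \<le> s; s \<le> r; 0 \<le> t; t \<le> r\<rbrakk> \<Longrightarrow>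
      (\<lambda>y. dir_deriv f y u) differentiable (at (x + s *\<^sub>R u + t *\<^sub>R v))"
    and r: "r > 0"
  obtains s t where "0 \<le> s" "s \<le> r" "0 \<le> t" "t \<le> r"
    "f (x + r *\<^sub>R u + r *\<^sub>R v) - f (x + r *\<^sub>R u) - f (x + r *\<^sub>R v) + f x =
     r\<^sup>2 * dir_deriv (\<lambda>y. dir_deriv f y u) (x + s *\<^sub>R u + t *\<^sub>R v) v"
proof -
  have line: "((\<lambda>s. g (y + s *\<^sub>R w)) has_real_derivative dir_deriv g (y + s *\<^sub>R w) w) (at s)"
    if "g differentiable (at (y + s *\<^sub>R w))" for g :: "'a \<Rightarrow> real" and y w s
  proof -
    have d: "(g has_derivative dir_deriv g (y + s *\<^sub>R w)) (at (y + s *\<^sub>R w))"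
      using that frechet_derivative_works by blast
    have "((\<lambda>s. g (y + s *\<^sub>R w)) has_derivative (\<lambda>k. dir_deriv g (y + s *\<^sub>R w) (k *\<^sub>R w))) (at s)"
      by (rule has_derivative_compose[of "\<lambda>s. y + s *\<^sub>R w", OF _ d]) (auto intro!: derivative_eq_intros)
    moreover have "(\<lambda>k. dir_deriv g (y + s *\<^sub>R w) (k *\<^sub>R w)) = (*) (dir_deriv g (y + s *\<^sub>R w) w)"
      using linear_frechet_derivative[OF that] by (auto simp: linear_scale)
    ultimately show ?thesis unfolding has_field_derivative_def by simp
  qed
  \<comment> \<open>The second difference is the increment in direction \<open>u\<close> of a
    difference in direction \<open>v\<close>; the mean value theorem is applied to each direction in
    turn.\<close>
  have "\<exists>z>0. z < r \<and> (\<lambda>s. f (x + s *\<^sub>R u + r *\<^sub>R v) - f (x + s *\<^sub>R u)) r -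
      (\<lambda>s. f (x + s *\<^sub>R u + r *\<^sub>R v) - f (x + s *\<^sub>R u)) 0 =
      (r - 0) * (dir_deriv f (x + z *\<^sub>R u + r *\<^sub>R v) u - dir_deriv f (x + z *\<^sub>R u) u)"
  proof (rule MVT2[OF r])
    fix s assume s: "0 \<le> s" "s \<le> r"
    have "((\<lambda>s. f (x + r *\<^sub>R v + s *\<^sub>R u)) has_real_derivative dir_deriv f (x + r *\<^sub>R v + s *\<^sub>R u) u) (at s)"
      by (rule line) (use f[of s r] s r in \<open>simp add: algebra_simps\<close>)
    moreover have "((\<lambda>s. f (x + s *\<^sub>R u)) has_real_derivative dir_deriv f (x + s *\<^sub>R u) u) (at s)"
      by (rule line) (use f[of s 0] s r in simp)
    ultimately show "((\<lambda>s. f (x + s *\<^sub>R u + r *\<^sub>R v) - f (x + s *\<^sub>R u)) has_real_derivative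
        dir_deriv f (x + s *\<^sub>R u + r *\<^sub>R v) u - dir_deriv f (x + s *\<^sub>R u) u) (at s)"
      by (auto intro!: derivative_eq_intros simp: add_ac)
  qed
  then obtain s where s: "0 < s" "s < r"
    and 1: "f (x + r *\<^sub>R u + r *\<^sub>R v) - f (x + r *\<^sub>R u) - (f (x + r *\<^sub>R v) - f x) =
      r * (dir_deriv f (x + s *\<^sub>R u + r *\<^sub>R v) u - dir_deriv f (x + s *\<^sub>R u) u)"
    by auto
  have "\<exists>z>0. z < r \<and> (\<lambda>t. dir_deriv f (x + s *\<^sub>R u + t *\<^sub>R v) u) r -
      (\<lambda>t. dir_deriv f (x + s *\<^sub>R u + t *\<^sub>R v) u) 0 =
      (r - 0) * dir_deriv (\<lambda>y. dir_deriv f y u) (x + s *\<^sub>R u + z *\<^sub>R v) v"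
    by (rule MVT2[OF r], rule line) (use Df s in auto)
  then obtain t where t: "0 < t" "t < r"
    and 2: "dir_deriv f (x + s *\<^sub>R u + r *\<^sub>R v) u - dir_deriv f (x + s *\<^sub>R u) u =
      r * dir_deriv (\<lambda>y. dir_deriv f y u) (x + s *\<^sub>R u + t *\<^sub>R v) v"
    by auto
  show thesis
    by (rule that[of s t]) (use s t 1 2 in \<open>auto simp: power2_eq_square\<close>)
qed

text \<open>By \<open>mixed_difference\<close>, both iterated derivatives, at points near
  \<open>x\<close>, equal the same second difference divided by the square of \<open>r\<close>,
  because that difference is symmetric in \<open>u\<close> and \<open>v\<close>. Continuity at
  \<open>x\<close> then makes them agree there up to any \<open>e\<close>.\<close>

lemma dir_deriv_commute_real:
  fixes f :: "'a::euclidean_space \<Rightarrow> real"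
  assumes S: "open S" "x \<in> S" and f: "smooth_on S f"
  shows "dir_deriv (\<lambda>y. dir_deriv f y u) x v = dir_deriv (\<lambda>y. dir_deriv f y v) x u"
    (is "?A x = ?B x")
proof -
  have contA: "isCont ?A x" and contB: "isCont ?B x"
    using smooth_on_continuous[OF smooth_on_dir_deriv[OF smooth_on_dir_deriv[OF f]]] S
    by (auto simp: continuous_on_eq_continuous_at)
  have "\<bar>?A x - ?B x\<bar> \<le> e" if e: "e > 0" for e
  proof -
    obtain d1 where d1: "d1 > 0" "\<And>y. dist y x < d1 \<Longrightarrow> dist (?A y) (?A x) < e/2"
      using contA e unfolding continuous_at_eps_delta by (metis half_gt_zero)
    obtain d2 where d2: "d2 > 0" "\<And>y. dist y x < d2 \<Longrightarrow> dist (?B y) (?B x) < e/2"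
      using contB e unfolding continuous_at_eps_delta by (metis half_gt_zero)
    obtain d3 where d3: "d3 > 0" "ball x d3 \<subseteq> S"
      using S open_contains_ball by blast
    define d where "d = min d1 (min d2 d3)"
    have d: "d > 0" using d1 d2 d3 by (simp add: d_def)
    \<comment> \<open>The parallelogram with edges \<open>r *\<^sub>R u\<close> and
      \<open>r *\<^sub>R v\<close> lies within distance \<open>d\<close> of \<open>x\<close>; the
      summand 1 covers \<open>u = v = 0\<close>.\<close>
    define r where "r = d / (norm u + norm v + 1)"
    have r: "r > 0" using d by (auto simp: r_def intro!: divide_pos_pos add_nonneg_pos)
    have near: "dist (x + s *\<^sub>R u + t *\<^sub>R v) x < d" if st: "0 \<le> s" "s \<le> r" "0 \<le> t" "t \<le> r" for s t
    proof -
      have "dist (x + s *\<^sub>R u + t *\<^sub>R v) x \<le> norm (s *\<^sub>R u) + norm (t *\<^sub>R v)"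
        using norm_triangle_ineq[of "s *\<^sub>R u" "t *\<^sub>R v"] by (simp add: dist_norm add.assoc)
      also have "\<dots> \<le> r * norm u + r * norm v"
        using st by (intro add_mono) (auto intro: mult_right_mono)
      also have "\<dots> < r * (norm u + norm v + 1)" using r by (simp add: algebra_simps)
      also have "\<dots> = d"
        by (simp add: r_def add_nonneg_pos order_less_imp_not_eq2)
      finally show ?thesis .
    qed
    have inS: "x + s *\<^sub>R u + t *\<^sub>R v \<in> S" if "0 \<le> s" "s \<le> r" "0 \<le> t" "t \<le> r" for s t
      using near[OF that] d3 by (auto simp: d_def dist_commute)
    have inS': "x + t *\<^sub>R v + s *\<^sub>R u \<in> S" if "0 \<le> s" "s \<le> r" "0 \<le> t" "t \<le> r" for s t
      using inS[OF that] by (simp add: add_ac)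
    have diff: "f differentiable (at y)" "(\<lambda>y. dir_deriv f y w) differentiable (at y)"
      if "y \<in> S" for y w
      using that f smooth_on_differentiable smooth_on_dir_deriv by blast+
    obtain s t where st: "0 \<le> s" "s \<le> r" "0 \<le> t" "t \<le> r" and
      1: "f (x + r *\<^sub>R u + r *\<^sub>R v) - f (x + r *\<^sub>R u) - f (x + r *\<^sub>R v) + f x =
         r\<^sup>2 * ?A (x + s *\<^sub>R u + t *\<^sub>R v)"
      using mixed_difference[of r f x u v] diff inS r by blast
    obtain s' t' where st': "0 \<le> s'" "s' \<le> r" "0 \<le> t'" "t' \<le> r" and
      2: "f (x + r *\<^sub>R v + r *\<^sub>R u) - f (x + r *\<^sub>R v) - f (x + r *\<^sub>R u) + f x =
         r\<^sup>2 * ?B (x + s' *\<^sub>R v + t' *\<^sub>R u)"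
      using mixed_difference[of r f x v u] diff inS' r by blast
    have "x + r *\<^sub>R v + r *\<^sub>R u = x + r *\<^sub>R u + r *\<^sub>R v" by simp
    then have "r\<^sup>2 * ?A (x + s *\<^sub>R u + t *\<^sub>R v) = r\<^sup>2 * ?B (x + s' *\<^sub>R v + t' *\<^sub>R u)"
      using 1 2[unfolded \<open>x + r *\<^sub>R v + r *\<^sub>R u = x + r *\<^sub>R u + r *\<^sub>R v\<close>] by linarith
    then have "?A (x + s *\<^sub>R u + t *\<^sub>R v) = ?B (x + s' *\<^sub>R v + t' *\<^sub>R u)"
      using r by simp
    moreover have "dist (?A (x + s *\<^sub>R u + t *\<^sub>R v)) (?A x) < e/2"
      using near[OF st] d1 by (auto simp: d_def)
    moreover have "dist (?B (x + s' *\<^sub>R v + t' *\<^sub>R u)) (?B x) < e/2"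
      using near[OF st'(3,4,1,2)] d2 by (auto simp: d_def add_ac)
    ultimately show ?thesis by (simp add: dist_real_def abs_if split: if_splits)
  qed
  then show ?thesis
    using field_le_epsilon[of "\<bar>?A x - ?B x\<bar>" 0] by fastforce
qed

section \<open>From real-valued to vector-valued functions\<close>

lemma dir_deriv_inner:
  fixes f :: "'a::euclidean_space \<Rightarrow> 'b::euclidean_space"
  assumes "f differentiable (at x)"
  shows "dir_deriv (\<lambda>y. f y \<bullet> b) x u = dir_deriv f x u \<bullet> b"
    "(\<lambda>y. f y \<bullet> b) differentiable (at x)"
proof -
  have "((\<lambda>y. f y \<bullet> b) has_derivative (\<lambda>u. dir_deriv f x u \<bullet> b)) (at x)"
    using assms by (auto intro!: derivative_eq_intros simp: frechet_derivative_works)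
  then show "dir_deriv (\<lambda>y. f y \<bullet> b) x u = dir_deriv f x u \<bullet> b"
      "(\<lambda>y. f y \<bullet> b) differentiable (at x)"
    by (auto simp: frechet_derivative_eqI differentiable_def)
qed

lemma Ck_on_cong:
  "open S \<Longrightarrow> (\<And>x. x \<in> S \<Longrightarrow> f x = g x) \<Longrightarrow> Ck_on k S f = Ck_on k S g"
proof (induction k arbitrary: f g)
  case 0 then show ?case by (simp cong: continuous_on_cong)
next
  case (Suc k)
  have "f differentiable (at x) \<longleftrightarrow> g differentiable (at x)" if "x \<in> S" for x
    using has_derivative_transform_within_open Suc.prems that
    unfolding differentiable_def by (metis (no_types, lifting))
  moreover have "dir_deriv f x v = dir_deriv g x v" if "x \<in> S" for x v
  proof (cases "f differentiable (at x)")
    case True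
    then show ?thesis
      using frechet_derivative_transform_within_open[OF True Suc.prems(1) that] Suc.prems(2) by metis
  next
    \<comment> \<open>Without a derivative, \<open>frechet_derivative\<close> is still a choice
      governed by the predicate \<open>has_derivative\<close>, which is the same for
      \<open>f\<close> and \<open>g\<close>.\<close>
    case False
    have "(f has_derivative f') (at x) \<longleftrightarrow> (g has_derivative f') (at x)" for f'
      using has_derivative_transform_within_open Suc.prems that by (metis (no_types, lifting))
    then show ?thesis unfolding frechet_derivative_def by simp
  qed
  moreover from this have "Ck_on k S (\<lambda>x. dir_deriv f x v) = Ck_on k S (\<lambda>x. dir_deriv g x v)" for v
    by (intro Suc.IH[OF Suc.prems(1)])
  ultimately show ?case by simp
qed

lemma Ck_on_inner:
  fixes f :: "'a::euclidean_space \<Rightarrow> 'b::euclidean_space"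
  shows "open S \<Longrightarrow> Ck_on k S f \<Longrightarrow> Ck_on k S (\<lambda>y. f y \<bullet> b)"
proof (induction k arbitrary: f)
  case 0 then show ?case by (auto intro!: continuous_intros)
next
  case (Suc k)
  then have "Ck_on k S (\<lambda>x. dir_deriv f x v \<bullet> b)" for v by simp
  moreover have "Ck_on k S (\<lambda>x. dir_deriv (\<lambda>y. f y \<bullet> b) x v) = Ck_on k S (\<lambda>x. dir_deriv f x v \<bullet> b)" for v
    by (rule Ck_on_cong) (use Suc.prems in \<open>auto intro: dir_deriv_inner(1)\<close>)
  ultimately have "Ck_on k S (\<lambda>x. dir_deriv (\<lambda>y. f y \<bullet> b) x v)" for v by simp
  then show ?case using Suc.prems dir_deriv_inner(2) by auto
qed

lemma dir_deriv_commute: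
  fixes f :: "'a::euclidean_space \<Rightarrow> 'b::euclidean_space"
  assumes S: "open S" "x \<in> S" and f: "smooth_on S f"
  shows "dir_deriv (\<lambda>y. dir_deriv f y u) x v = dir_deriv (\<lambda>y. dir_deriv f y v) x u"
proof (rule euclidean_eqI)
  fix b :: 'b
  have "dir_deriv (\<lambda>y. dir_deriv f y u) x v \<bullet> b = dir_deriv (\<lambda>y. dir_deriv (\<lambda>z. f z \<bullet> b) y u) x v" for u v
  proof -
    have "dir_deriv (\<lambda>y. dir_deriv f y u) x v \<bullet> b = dir_deriv (\<lambda>y. dir_deriv f y u \<bullet> b) x v"
      using S f smooth_on_differentiable smooth_on_dir_deriv by (metis dir_deriv_inner(1))
    also have "\<dots> = dir_deriv (\<lambda>y. dir_deriv (\<lambda>z. f z \<bullet> b) y u) x v"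
      by (rule frechet_derivative_transform_within_open[THEN fun_cong, OF _ S])
        (use S f in \<open>auto intro!: dir_deriv_inner smooth_on_differentiable smooth_on_dir_deriv
          simp: dir_deriv_inner(1)[OF smooth_on_differentiable[OF f]]\<close>)
    finally show ?thesis .
  qed
  moreover have "smooth_on S (\<lambda>z. f z \<bullet> b)"
    unfolding smooth_on_def by (intro allI Ck_on_inner[OF S(1)]) (use f in \<open>simp add: smooth_on_def\<close>)
  ultimately show "dir_deriv (\<lambda>y. dir_deriv f y u) x v \<bullet> b = dir_deriv (\<lambda>y. dir_deriv f y v) x u \<bullet> b"
    using dir_deriv_commute_real[OF S] by metis
qed

text \<open>Expanding the argument in the standard basis reduces the claim to finitely many products
  of a scalar and a field \<open>T y b\<close>. The derivative of \<open>T\<close> with frozen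
  argument is left as \<open>dir_deriv\<close>, so that the \<open>T'\<close> of the hypothesis does
  not enter later formulas.\<close>

lemma has_derivative_linear_field:
  fixes Z :: "'a::euclidean_space \<Rightarrow> 'd::euclidean_space"
  assumes lin: "\<And>y. y \<in> S \<Longrightarrow> linear (T y)" and S: "open S" "x \<in> S"
    and T: "\<And>v. v \<in> Basis \<Longrightarrow> ((\<lambda>y. T y v) has_derivative (T' v)) (at x)"
    and Z: "(Z has_derivative Z') (at x)"
  shows "((\<lambda>y. T y (Z y)) has_derivative
    (\<lambda>u. dir_deriv (\<lambda>y. T y (Z x)) x u + T x (Z' u))) (at x)"
proof -
  have ex: "T y w = (\<Sum>b\<in>Basis. (w \<bullet> b) *\<^sub>R T y b)" if "y \<in> S" for y w
    by (subst euclidean_representation[of w, symmetric])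
      (simp add: linear_sum[OF lin[OF that]] linear_scale[OF lin[OF that]] del: euclidean_representation)
  have c: "((\<lambda>y. T y w) has_derivative (\<lambda>u. \<Sum>b\<in>Basis. (w \<bullet> b) *\<^sub>R T' b u)) (at x)" for w
    by (rule has_derivative_transform_within_open[OF _ S, of "\<lambda>y. \<Sum>b\<in>Basis. (w \<bullet> b) *\<^sub>R T y b"])
      (use T ex in \<open>auto intro!: derivative_eq_intros\<close>)
  have "((\<lambda>y. T y (Z y)) has_derivative
      (\<lambda>u. \<Sum>b\<in>Basis. (Z x \<bullet> b) *\<^sub>R T' b u + (Z' u \<bullet> b) *\<^sub>R T x b)) (at x)"
    by (rule has_derivative_transform_within_open[OF _ S, of "\<lambda>y. \<Sum>b\<in>Basis. (Z y \<bullet> b) *\<^sub>R T y b"])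
      (use T Z ex in \<open>auto intro!: derivative_eq_intros\<close>)
  moreover have "(\<lambda>u. \<Sum>b\<in>Basis. (Z x \<bullet> b) *\<^sub>R T' b u + (Z' u \<bullet> b) *\<^sub>R T x b) =
      (\<lambda>u. dir_deriv (\<lambda>y. T y (Z x)) x u + T x (Z' u))"
    by (rule ext) (simp add: frechet_derivative_eqI[OF c] sum.distrib ex[OF S(2), of "Z' _"])
  ultimately show "((\<lambda>y. T y (Z y)) has_derivative
    (\<lambda>u. dir_deriv (\<lambda>y. T y (Z x)) x u + T x (Z' u))) (at x)" by simp
qed

section \<open>Levi-Civita connection in a chart\<close>

locale inner_form =
  fixes q :: "'e::euclidean_space \<Rightarrow> 'e \<Rightarrow> real"
  assumes bilin: "bilinear q" and sym: "q u v = q v u" and pos: "u \<noteq> 0 \<Longrightarrow> q u u > 0"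
begin

lemma linear_left: "linear (\<lambda>u. q u v)" and linear_right: "linear (q u)"
  using bilin by (auto simp: bilinear_def)

lemmas form_simps =
  linear_add[OF linear_left] linear_add[OF linear_right] linear_diff[OF linear_left]
  linear_diff[OF linear_right] linear_scale[OF linear_left] linear_scale[OF linear_right]
  linear_neg[OF linear_left] linear_neg[OF linear_right] linear_0[OF linear_left]
  linear_0[OF linear_right]

lemmas form_sum = linear_sum[OF linear_left] linear_sum[OF linear_right]

lemma nonneg: "q u u \<ge> 0"
  using pos[of u] by (cases "u = 0") (auto simp: form_simps)

lemma eq_0_iff: "q u u = 0 \<longleftrightarrow> u = 0"
  using pos[of u] by (cases "u = 0") (auto simp: form_simps)

lemma eqI: "(\<And>w. q u w = q v w) \<Longrightarrow> u = v"
  using eq_0_iff[of "u - v"] by (simp add: form_simps)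

lemma riesz:
  assumes "linear \<phi>"
  obtains v where "\<And>w. q v w = \<phi> w"
proof -
  \<comment> \<open>\<open>A c\<close> lists the values of the functional \<open>q c\<close> on the
    standard basis. Definiteness makes \<open>A\<close> injective, hence onto.\<close>
  define A where "A = (\<lambda>c. \<Sum>b\<in>Basis. q c b *\<^sub>R b)"
  have A_Basis: "A c \<bullet> b = q c b" if "b \<in> Basis" for c b
    using that by (simp add: A_def inner_sum_left_Basis)
  have lin: "linear A"
    unfolding A_def by (intro linear_compose_sum linearI ballI) (auto simp: form_simps scaleR_add_left)
  have "inj A"
  proof (subst linear_injective_0[OF lin], intro allI impI)
    fix c assume "A c = 0"
    then have "q c b = 0" if "b \<in> Basis" for b using A_Basis[OF that, of c] by simp
    then have "q c c = 0"
      by (subst (2) euclidean_representation[of c, symmetric])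
        (simp add: form_sum form_simps del: euclidean_representation)
    then show "c = 0" using eq_0_iff by blast
  qed
  then have "surj A" using linear_injective_imp_surjective[OF lin] by blast
  then obtain v where v: "A v = (\<Sum>b\<in>Basis. \<phi> b *\<^sub>R b)" by (metis surjD)
  have "q v w = \<phi> w" for w
  proof -
    have "q v b = \<phi> b" if "b \<in> Basis" for b
      using A_Basis[OF that, of v] that by (simp add: v inner_sum_left_Basis)
    moreover have "\<phi> w = (\<Sum>b\<in>Basis. (w \<bullet> b) * \<phi> b)"
      by (subst euclidean_representation[of w, symmetric])
        (simp add: linear_sum[OF assms] linear_scale[OF assms] del: euclidean_representation)
    moreover have "q v w = (\<Sum>b\<in>Basis. (w \<bullet> b) * q v b)"
      by (subst euclidean_representation[of w, symmetric])
        (simp add: form_sum form_simps del: euclidean_representation)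
    ultimately show ?thesis by simp
  qed
  then show thesis using that by blast
qed

end

text \<open>Apply \<open>has_derivative_linear_field\<close> once in each bilinear argument. The
  base point runs through \<open>\<phi>\<close>, so that \<open>K\<close> may be the metric or the
  Christoffel map of the target, evaluated along an immersion.\<close>

lemma has_derivative_bilinear_field:
  fixes Z :: "'a::euclidean_space \<Rightarrow> 'd::euclidean_space" and W :: "'a \<Rightarrow> 'e::euclidean_space"
    and \<phi> :: "'a \<Rightarrow> 'c::euclidean_space" and K :: "'c \<Rightarrow> 'd \<Rightarrow> 'e \<Rightarrow> 'f::real_normed_vector"
  assumes bil: "\<And>y. y \<in> T \<Longrightarrow> bilinear (K y)" and S: "open S" "x \<in> S" "\<phi> ` S \<subseteq> T"
    and K: "\<And>v w. (\<lambda>y. K y v w) differentiable (at (\<phi> x))"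
    and \<phi>: "\<phi> differentiable (at x)" and Z: "Z differentiable (at x)" and W: "W differentiable (at x)"
  shows "((\<lambda>y. K (\<phi> y) (Z y) (W y)) has_derivative
    (\<lambda>u. dir_deriv (\<lambda>y. K y (Z x) (W x)) (\<phi> x) (dir_deriv \<phi> x u) +
      K (\<phi> x) (dir_deriv Z x u) (W x) + K (\<phi> x) (Z x) (dir_deriv W x u))) (at x)"
proof -
  have 1: "((\<lambda>y. K (\<phi> y) v w) has_derivative (\<lambda>u. dir_deriv (\<lambda>y. K y v w) (\<phi> x) (dir_deriv \<phi> x u))) (at x)" for v w
    by (rule has_derivative_compose[of \<phi>]) (use K \<phi> frechet_derivative_works in blast)+
  have lin: "linear (K (\<phi> y) v)" "linear (\<lambda>v. K (\<phi> y) v w)" if "y \<in> S" for y v w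
    using bil[of "\<phi> y"] S that by (auto simp: bilinear_def)
  have 2: "((\<lambda>y. K (\<phi> y) v (W y)) has_derivative
      (\<lambda>u. dir_deriv (\<lambda>y. K (\<phi> y) v (W x)) x u + K (\<phi> x) v (dir_deriv W x u))) (at x)" for v
    by (rule has_derivative_linear_field[OF lin(1) S(1,2) 1 frechet_derivative_works[THEN iffD1, OF W]]) auto
  have "((\<lambda>y. (\<lambda>v. K (\<phi> y) v (W y)) (Z y)) has_derivative
      (\<lambda>u. dir_deriv (\<lambda>y. K (\<phi> y) (Z x) (W y)) x u + K (\<phi> x) (dir_deriv Z x u) (W x))) (at x)"
    by (rule has_derivative_linear_field[OF lin(2) S(1,2) 2 frechet_derivative_works[THEN iffD1, OF Z]]) auto
  moreover have "dir_deriv (\<lambda>y. K (\<phi> y) (Z x) (W y)) x u =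
      dir_deriv (\<lambda>y. K y (Z x) (W x)) (\<phi> x) (dir_deriv \<phi> x u) + K (\<phi> x) (Z x) (dir_deriv W x u)" for u
    by (simp only: frechet_derivative_eqI[OF 2] frechet_derivative_eqI[OF 1])
  ultimately show ?thesis by (simp add: add_ac)
qed

text \<open>The map \<open>(y, v) \<mapsto> (y, A y v)\<close> has the inverse \<open>(y, w) \<mapsto> (y, (A y)\<^sup>-\<^sup>1 w)\<close>, which is differentiable by
  the inverse function theorem.\<close>

lemma differentiable_linear_solution:
  fixes A :: "'a::euclidean_space \<Rightarrow> 'e::euclidean_space \<Rightarrow> 'e"
  assumes S: "open S" "x \<in> S"
    and A: "\<And>y. y \<in> S \<Longrightarrow> linear (A y)" "\<And>y. y \<in> S \<Longrightarrow> inj (A y)"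
      "\<And>y v. y \<in> S \<Longrightarrow> (\<lambda>y. A y v) differentiable (at y)"
    and c: "\<And>y. y \<in> S \<Longrightarrow> A y (c y) = k y" and k: "k differentiable (at x)"
  shows "c differentiable (at x)"
proof -
  define L where "L y v = dir_deriv (\<lambda>z. A z v) y" for y v
  define \<Phi> where "\<Phi> = (\<lambda>p. (fst p, A (fst p) (snd p)))"
  have der: "(\<Phi> has_derivative (\<lambda>d. (fst d, L y v (fst d) + A y (snd d)))) (at (y, v))"
    if y: "y \<in> S" for y v
  proof -
    have 1: "((\<lambda>p. A (fst p) w) has_derivative (\<lambda>d. L y w (fst d))) (at (y, v))" for w
      by (rule has_derivative_compose[of fst fst]) (use A(3)[OF y] in
        \<open>auto simp: L_def has_derivative_fst[OF has_derivative_ident] frechet_derivative_works\<close>)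
    have "((\<lambda>p. A (fst p) (snd p)) has_derivative
      (\<lambda>d. dir_deriv (\<lambda>p. A (fst p) (snd (y, v))) (y, v) d + A (fst (y, v)) (snd d))) (at (y, v))"
      by (rule has_derivative_linear_field[where S = "S \<times> UNIV", OF _ _ _ 1])
        (use A(1) S y in \<open>auto intro: open_Times has_derivative_snd[OF has_derivative_ident]\<close>)
    then show ?thesis
      unfolding \<Phi>_def by (auto intro!: has_derivative_Pair has_derivative_fst[OF has_derivative_ident]
        simp: frechet_derivative_eqI[OF 1])
  qed
  define g where "g = (\<lambda>p. (fst p, inv (A (fst p)) (snd p)))"
  \<comment> \<open>Inverts the derivative of \<open>\<Phi>\<close>: subtract the contribution of
    moving the base point, then undo \<open>A x\<close>.\<close>
  define g' where "g' = (\<lambda>d. (fst d, inv (A x) (snd d - L x (c x) (fst d))))"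
  have surj: "surj (A x)"
    using A S linear_injective_imp_surjective by blast
  have "(g has_derivative g') (at (\<Phi> (x, c x)))"
  proof (rule has_derivative_inverse_strong[where S = "S \<times> UNIV" and f = \<Phi> and x = "(x, c x)"])
    show "open (S \<times> (UNIV :: 'e set))" "(x, c x) \<in> S \<times> UNIV" using S by (auto intro: open_Times)
    show "continuous_on (S \<times> UNIV) \<Phi>"
      by (rule continuous_at_imp_continuous_on) (use der in \<open>auto dest: has_derivative_continuous\<close>)
    show "g (\<Phi> p) = p" if "p \<in> S \<times> UNIV" for p
      using that A(2) by (auto simp: g_def \<Phi>_def)
    show "(\<Phi> has_derivative (\<lambda>d. (fst d, L x (c x) (fst d) + A x (snd d)))) (at (x, c x))"
      by (rule der[OF S(2)])
    show "(\<lambda>d. (fst d, L x (c x) (fst d) + A x (snd d))) \<circ> g' = id"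
      by (auto simp: g'_def surj_f_inv_f[OF surj])
  qed
  moreover have "((\<lambda>y. (y, k y)) has_derivative (\<lambda>u. (u, dir_deriv k x u))) (at x)"
    using k by (auto intro!: has_derivative_Pair has_derivative_ident simp: frechet_derivative_works)
  moreover have "\<Phi> (x, c x) = (x, k x)" using c S by (simp add: \<Phi>_def)
  ultimately have "((\<lambda>y. g (y, k y)) has_derivative (\<lambda>u. g' (u, dir_deriv k x u))) (at x)"
    by (auto intro: has_derivative_compose)
  then have "((\<lambda>y. snd (g (y, k y))) has_derivative (\<lambda>u. snd (g' (u, dir_deriv k x u)))) (at x)"
    by (rule has_derivative_snd)
  then have "(c has_derivative (\<lambda>u. snd (g' (u, dir_deriv k x u)))) (at x)"
    by (rule has_derivative_transform_within_open[OF _ S]) (use A(2) c in \<open>auto simp: g_def inv_f_eq\<close>)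
  then show ?thesis by (auto simp: differentiable_def)
qed

text \<open>Right-hand side of the Koszul formula, that is twice the inner product of the derivative
  of \<open>v\<close> along \<open>u\<close> with \<open>w\<close>, for fields with constant
  components, whose bracket terms vanish.\<close>

definition koszul :: "'e::euclidean_space local_metric \<Rightarrow> 'e \<Rightarrow> 'e \<Rightarrow> 'e \<Rightarrow> 'e \<Rightarrow> real" where
  "koszul G x u v w = dir_deriv (\<lambda>y. G y v w) x u + dir_deriv (\<lambda>y. G y u w) x v
     - dir_deriv (\<lambda>y. G y u v) x w"

text \<open>Curvature involves only two derivatives of the metric. Asking for just these lets the
  warped metric qualify by the product rule, without an induction over \<open>Ck_on\<close>.\<close>

locale riemannian_patch =
  fixes S :: "'e::euclidean_space set" and G :: "'e local_metric"
  assumes open_S: "open S" and form: "x \<in> S \<Longrightarrow> inner_form (G x)"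
    and diff1: "x \<in> S \<Longrightarrow> (\<lambda>y. G y u v) differentiable (at x)"
    and diff2: "x \<in> S \<Longrightarrow> (\<lambda>y. dir_deriv (\<lambda>z. G z u v) y w) differentiable (at x)"
begin

lemma dir_deriv_sym:
  assumes "x \<in> S" shows "dir_deriv (\<lambda>y. G y u v) x w = dir_deriv (\<lambda>y. G y v u) x w"
  using frechet_derivative_transform_within_open[OF diff1[OF assms, of u v] open_S assms, where g = "\<lambda>y. G y v u"]
    inner_form.sym[OF form] by (metis (no_types, lifting))

lemma linear_dir_deriv:
  assumes x: "x \<in> S"
  shows "linear (\<lambda>v. dir_deriv (\<lambda>y. G y u v) x w)" "linear (\<lambda>u. dir_deriv (\<lambda>y. G y u v) x w)"
    "linear (dir_deriv (\<lambda>y. G y u v) x)"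
proof -
  note d = diff1[OF x, unfolded frechet_derivative_works]
  show *: "linear (\<lambda>v. dir_deriv (\<lambda>y. G y u v) x w)" for u
  proof
    fix v v' and r :: real
    have "((\<lambda>y. G y u (v + v')) has_derivative
        (\<lambda>w. dir_deriv (\<lambda>y. G y u v) x w + dir_deriv (\<lambda>y. G y u v') x w)) (at x)"
      by (rule has_derivative_transform_within_open[OF has_derivative_add[OF d d] open_S x])
        (simp add: inner_form.form_simps form)
    then show "dir_deriv (\<lambda>y. G y u (v + v')) x w =
        dir_deriv (\<lambda>y. G y u v) x w + dir_deriv (\<lambda>y. G y u v') x w"
      by (simp add: frechet_derivative_eqI)
    have "((\<lambda>y. G y u (r *\<^sub>R v)) has_derivative (\<lambda>w. r *\<^sub>R dir_deriv (\<lambda>y. G y u v) x w)) (at x)"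
      by (rule has_derivative_transform_within_open[OF has_derivative_scaleR_right[OF d] open_S x])
        (simp add: inner_form.form_simps form)
    then show "dir_deriv (\<lambda>y. G y u (r *\<^sub>R v)) x w = r *\<^sub>R dir_deriv (\<lambda>y. G y u v) x w"
      by (simp add: frechet_derivative_eqI)
  qed
  show "linear (\<lambda>u. dir_deriv (\<lambda>y. G y u v) x w)"
    unfolding dir_deriv_sym[OF x, of _ v] by (rule *)
  show "linear (dir_deriv (\<lambda>y. G y u v) x)"
    by (rule linear_frechet_derivative[OF diff1[OF x]])
qed

lemma koszul_compatible:
  "x \<in> S \<Longrightarrow> koszul G x u v w + koszul G x u w v = 2 * dir_deriv (\<lambda>y. G y v w) x u"
  using dir_deriv_sym[of x u v w] dir_deriv_sym[of x u w v] dir_deriv_sym[of x v w u]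
  by (simp add: koszul_def)

text \<open>After compatibility is substituted into the three terms of \<open>koszul\<close>,
  symmetry of \<open>C\<close> cancels everything except two equal terms. This yields uniqueness of
  the connection as well as the formula for \<open>christoffel\<close>.\<close>

lemma koszul_unique:
  assumes x: "x \<in> S" and sym: "\<And>u v. C u v = C v u"
    and compat: "\<And>u v w. dir_deriv (\<lambda>y. G y v w) x u = G x (C u v) w + G x v (C u w)"
  shows "2 * G x (C u v) w = koszul G x u v w"
proof -
  show ?thesis
    unfolding koszul_def compat sym[of v u] sym[of w u] sym[of w v]
    using inner_form.sym[OF form[OF x], of v "C u w"] by linarith
qed

text \<open>The definite description needs existence and uniqueness. \<open>riesz\<close> turns half
  of the Koszul expression into a vector, and nondegeneracy transfers bilinearity and symmetry from
  the expression to that vector.\<close>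

lemma christoffel_works:
  assumes x: "x \<in> S"
  shows christoffel_bilinear: "bilinear (christoffel G x)"
    and christoffel_sym: "christoffel G x u v = christoffel G x v u"
    and christoffel_compatible: "dir_deriv (\<lambda>y. G y v w) x u =
      G x (christoffel G x u v) w + G x v (christoffel G x u w)"
proof -
  interpret inner_form "G x" by (rule form[OF x])
  let ?P = "\<lambda>\<Gamma>. bilinear \<Gamma> \<and> (\<forall>u v. \<Gamma> u v = \<Gamma> v u) \<and>
     (\<forall>u v w. dir_deriv (\<lambda>y. G y v w) x u = G x (\<Gamma> u v) w + G x v (\<Gamma> u w))"
  have lin: "linear (\<lambda>w. koszul G x u v w)" "linear (\<lambda>v. koszul G x u v w)"
    "linear (\<lambda>u. koszul G x u v w)" for u v w
    unfolding koszul_def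
    by (intro linear_compose_sub linear_compose_add linear_dir_deriv[OF x])+
  have "\<exists>c. \<forall>w. G x c w = koszul G x u v w / 2" for u v
    using riesz[of "\<lambda>w. koszul G x u v w / 2"] lin(1)[of u v]
      linear_compose_scale_right[of "koszul G x u v" "1/2"] by (auto simp: field_simps)
  then obtain \<Gamma> where \<Gamma>: "G x (\<Gamma> u v) w = koszul G x u v w / 2" for u v w
    by metis
  have "bilinear \<Gamma>"
    unfolding bilinear_def
  proof (intro conjI allI linearI)
    fix a b c :: 'e and r :: real
    show "\<Gamma> a (b + c) = \<Gamma> a b + \<Gamma> a c" "\<Gamma> (b + c) a = \<Gamma> b a + \<Gamma> c a"
      "\<Gamma> a (r *\<^sub>R b) = r *\<^sub>R \<Gamma> a b" "\<Gamma> (r *\<^sub>R b) a = r *\<^sub>R \<Gamma> b a"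
      by (rule eqI; simp add: \<Gamma> form_simps linear_add[OF lin(2)] linear_add[OF lin(3)]
        linear_scale[OF lin(2)] linear_scale[OF lin(3)] add_divide_distrib)+
  qed
  moreover have "\<Gamma> u v = \<Gamma> v u" for u v
    by (rule eqI) (simp add: \<Gamma> koszul_def dir_deriv_sym[OF x, of u v])
  moreover have "dir_deriv (\<lambda>y. G y v w) x u = G x (\<Gamma> u v) w + G x v (\<Gamma> u w)" for u v w
    using koszul_compatible[OF x, of u v w] sym[of v "\<Gamma> u w"] by (simp add: \<Gamma>)
  ultimately have ex: "?P \<Gamma>" by blast
  have "C = \<Gamma>" if "?P C" for C
  proof (intro ext eqI)
    fix u v w
    show "G x (C u v) w = G x (\<Gamma> u v) w"
      using koszul_unique[OF x, of C u v w] koszul_unique[OF x, of \<Gamma> u v w] that ex by simp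
  qed
  then have "?P (christoffel G x)"
    unfolding christoffel_def by (rule theI[of ?P, OF ex])
  then show "bilinear (christoffel G x)" "christoffel G x u v = christoffel G x v u"
    "dir_deriv (\<lambda>y. G y v w) x u = G x (christoffel G x u v) w + G x v (christoffel G x u w)"
    by blast+
qed

lemma christoffel_koszul:
  "x \<in> S \<Longrightarrow> 2 * G x (christoffel G x u v) w = koszul G x u v w"
  by (rule koszul_unique) (auto simp: christoffel_sym christoffel_compatible)

lemma christoffel_eqI:
  assumes "x \<in> S" "\<And>w. 2 * G x c w = koszul G x u v w"
  shows "christoffel G x u v = c"
proof -
  interpret inner_form "G x" by (rule form[OF assms(1)])
  show ?thesis using christoffel_koszul[OF assms(1), of u v] assms(2)
    by (intro eqI) (metis mult_cancel_left zero_neq_numeral)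
qed

text \<open>The inner products of \<open>christoffel G y u v\<close> with the standard basis are
  \<open>koszul G y u v b / 2\<close>. This is a linear system with invertible coefficients whose
  two sides depend differentiably on \<open>y\<close>.\<close>

lemma christoffel_differentiable:
  assumes x: "x \<in> S"
  shows "(\<lambda>y. christoffel G y u v) differentiable (at x)"
proof (rule differentiable_linear_solution[OF open_S x])
  fix y assume y: "y \<in> S"
  interpret inner_form "G y" by (rule form[OF y])
  show "linear (\<lambda>c. \<Sum>b\<in>Basis. G y c b *\<^sub>R b)"
    by (intro linear_compose_sum linearI ballI) (auto simp: form_simps scaleR_add_left)
  then show "inj (\<lambda>c. \<Sum>b\<in>Basis. G y c b *\<^sub>R b)"
  proof (subst linear_injective_0, assumption, intro allI impI)
    fix c assume "(\<Sum>b\<in>Basis. G y c b *\<^sub>R b) = 0"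
    then have "G y c b = 0" if "b \<in> Basis" for b
      using that by (metis inner_sum_left_Basis inner_zero_left)
    then have "G y c c = 0"
      by (subst (2) euclidean_representation[of c, symmetric])
        (simp add: form_sum form_simps del: euclidean_representation)
    then show "c = 0" using eq_0_iff by blast
  qed
  show "(\<lambda>z. \<Sum>b\<in>Basis. G z w b *\<^sub>R b) differentiable (at y)" for w
    by (intro differentiable_sum ballI differentiable_scaleR diff1[OF y]) auto
  show "(\<Sum>b\<in>Basis. G y (christoffel G y u v) b *\<^sub>R b) = (\<Sum>b\<in>Basis. (koszul G y u v b / 2) *\<^sub>R b)"
    by (simp add: christoffel_koszul[OF y, symmetric])
next
  show "(\<lambda>y. \<Sum>b\<in>Basis. (koszul G y u v b / 2) *\<^sub>R b) differentiable (at x)"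
    unfolding koszul_def divide_real_def
    by (intro differentiable_sum ballI differentiable_scaleR differentiable_mult differentiable_add
      differentiable_diff diff2[OF x]) auto
qed

lemma covariant_derivative_const:
  "covariant_derivative G x u (\<lambda>_. v) = christoffel G x u v"
  by (simp add: covariant_derivative_def)

end

section \<open>The Gauss equation\<close>

text \<open>Has two uses: the immersion of the warped product, and the transition maps between
  charts of the Grassmannian.\<close>

locale isometric_patch = source: riemannian_patch S G + target: riemannian_patch T H
  for S :: "'e::euclidean_space set" and G and T :: "'d::euclidean_space set" and H +
  fixes \<psi> :: "'e \<Rightarrow> 'd"
  assumes smooth: "smooth_on S \<psi>" and into: "\<psi> ` S \<subseteq> T"
    and isometric: "x \<in> S \<Longrightarrow> G x u v = H (\<psi> x) (dir_deriv \<psi> x u) (dir_deriv \<psi> x v)"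
begin

abbreviation d\<psi> :: "'e \<Rightarrow> 'e \<Rightarrow> 'd" where "d\<psi> v x \<equiv> dir_deriv \<psi> x v"

abbreviation along :: "'e \<Rightarrow> 'e \<Rightarrow> ('e \<Rightarrow> 'd) \<Rightarrow> 'd" where
  "along \<equiv> covariant_derivative_along H \<psi>"

abbreviation sff :: "'e \<Rightarrow> 'e \<Rightarrow> 'e \<Rightarrow> 'd" where
  "sff \<equiv> second_fundamental_form G H \<psi>"

lemma target_point: "x \<in> S \<Longrightarrow> \<psi> x \<in> T"
  using into by blast

lemma diff_\<psi>: "x \<in> S \<Longrightarrow> \<psi> differentiable (at x)"
  by (rule smooth_on_differentiable[OF smooth])

lemma diff_d\<psi>: "x \<in> S \<Longrightarrow> d\<psi> v differentiable (at x)"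
  by (rule smooth_on_differentiable[OF smooth_on_dir_deriv[OF smooth]])

lemma diff_dd\<psi>: "x \<in> S \<Longrightarrow> (\<lambda>y. dir_deriv (d\<psi> v) y u) differentiable (at x)"
  by (rule smooth_on_differentiable[OF smooth_on_dir_deriv[OF smooth_on_dir_deriv[OF smooth]]])

lemma linear_d\<psi>: "x \<in> S \<Longrightarrow> linear (dir_deriv \<psi> x)"
  by (rule linear_frechet_derivative[OF diff_\<psi>])

lemma along_d\<psi>: "along x u (d\<psi> v) = dir_deriv (d\<psi> v) x u + christoffel H (\<psi> x) (d\<psi> u x) (d\<psi> v x)"
  by (simp add: covariant_derivative_along_def)

lemma along_d\<psi>_sym:
  assumes x: "x \<in> S" shows "along x u (d\<psi> v) = along x v (d\<psi> u)"
  unfolding along_d\<psi> using dir_deriv_commute[OF source.open_S x smooth, of u v]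
    target.christoffel_sym[OF target_point[OF x], of "d\<psi> u x" "d\<psi> v x"] by simp

lemma second_fundamental_form_eq: "sff x u v = along x u (d\<psi> v) - dir_deriv \<psi> x (christoffel G x u v)"
  by (simp add: second_fundamental_form_def covariant_derivative_def)

lemma second_fundamental_form_sym:
  assumes x: "x \<in> S" shows "sff x u v = sff x v u"
  unfolding second_fundamental_form_eq
  using along_d\<psi>_sym[OF x, of u v] source.christoffel_sym[OF x, of u v] by simp

lemma along_metric:
  assumes x: "x \<in> S" and Z: "Z differentiable (at x)" and W: "W differentiable (at x)"
  shows "dir_deriv (\<lambda>y. H (\<psi> y) (Z y) (W y)) x u =
    H (\<psi> x) (along x u Z) (W x) + H (\<psi> x) (Z x) (along x u W)"
proof -
  interpret f: inner_form "H (\<psi> x)" by (rule target.form[OF target_point[OF x]])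
  have "bilinear (H y)" if "y \<in> T" for y using target.form[OF that] inner_form.bilin by blast
  then show ?thesis
    by (subst frechet_derivative_eqI[OF has_derivative_bilinear_field[OF _ source.open_S x into
        target.diff1[OF target_point[OF x]] diff_\<psi>[OF x] Z W]])
      (auto simp: target.christoffel_compatible[OF target_point[OF x]]
        covariant_derivative_along_def f.form_simps)
qed

text \<open>\<open>second_fundamental_form\<close> extends \<open>v\<close> by constant components.
  For a variable field the derivative of its components adds only a tangential term, which joins the
  covariant derivative.\<close>

lemma along_tangent:
  assumes x: "x \<in> S" and Y: "Y differentiable (at x)"
  shows "along x u (\<lambda>y. dir_deriv \<psi> y (Y y)) =
    dir_deriv \<psi> x (covariant_derivative G x u Y) + sff x u (Y x)"
    and "(\<lambda>y. dir_deriv \<psi> y (Y y)) differentiable (at x)"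
proof -
  have 1: "((\<lambda>y. dir_deriv \<psi> y (Y y)) has_derivative
      (\<lambda>u. dir_deriv (\<lambda>y. dir_deriv \<psi> y (Y x)) x u + dir_deriv \<psi> x (dir_deriv Y x u))) (at x)"
    by (rule has_derivative_linear_field[OF linear_d\<psi> source.open_S x
      frechet_derivative_works[THEN iffD1, OF diff_d\<psi>[OF x]]
      frechet_derivative_works[THEN iffD1, OF Y]]) auto
  show "along x u (\<lambda>y. dir_deriv \<psi> y (Y y)) =
    dir_deriv \<psi> x (covariant_derivative G x u Y) + sff x u (Y x)"
    unfolding second_fundamental_form_eq covariant_derivative_along_def
    by (simp add: frechet_derivative_eqI[OF 1] covariant_derivative_def linear_add[OF linear_d\<psi>[OF x]])
  show "(\<lambda>y. dir_deriv \<psi> y (Y y)) differentiable (at x)"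
    using 1 by (auto simp: differentiable_def)
qed

text \<open>When the induced metric is inserted into the Koszul formula of the source, the symmetry
  of \<open>along\<close> cancels all terms but one product: the tangential part of
  \<open>along\<close> is the image of the Levi-Civita derivative of the source. What remains is
  normal.\<close>

lemma second_fundamental_form_normal:
  assumes x: "x \<in> S"
  shows "H (\<psi> x) (sff x u v) (d\<psi> w x) = 0"
proof -
  interpret f: inner_form "H (\<psi> x)" by (rule target.form[OF target_point[OF x]])
  have D: "dir_deriv (\<lambda>y. G y v w) x u =
      H (\<psi> x) (along x u (d\<psi> v)) (d\<psi> w x) + H (\<psi> x) (d\<psi> v x) (along x u (d\<psi> w))" for u v w
  proof -
    have "dir_deriv (\<lambda>y. G y v w) x = dir_deriv (\<lambda>y. H (\<psi> y) (d\<psi> v y) (d\<psi> w y)) x"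
      by (rule frechet_derivative_transform_within_open[OF source.diff1[OF x] source.open_S x])
        (rule isometric)
    then show ?thesis using along_metric[OF x diff_d\<psi>[OF x] diff_d\<psi>[OF x]] by simp
  qed
  have "2 * H (\<psi> x) (dir_deriv \<psi> x (christoffel G x u v)) (d\<psi> w x) =
      2 * H (\<psi> x) (along x u (d\<psi> v)) (d\<psi> w x)"
    using source.christoffel_koszul[OF x, of u v w]
    unfolding koszul_def D isometric[OF x]
    using along_d\<psi>_sym[OF x, of v u] along_d\<psi>_sym[OF x, of w u] along_d\<psi>_sym[OF x, of w v]
      f.sym[of "d\<psi> u x" "along x v (d\<psi> w)"] f.sym[of "d\<psi> v x" "along x u (d\<psi> w)"]
    by simp
  then show ?thesis by (simp add: second_fundamental_form_eq f.form_simps)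
qed

lemma along_d\<psi>_has_derivative:
  assumes x: "x \<in> S"
  shows "((\<lambda>y. along y u (d\<psi> v)) has_derivative
    (\<lambda>w. dir_deriv (\<lambda>y. dir_deriv (d\<psi> v) y u) x w +
      (dir_deriv (\<lambda>y. christoffel H y (d\<psi> u x) (d\<psi> v x)) (\<psi> x) (d\<psi> w x) +
       christoffel H (\<psi> x) (dir_deriv (d\<psi> u) x w) (d\<psi> v x) +
       christoffel H (\<psi> x) (d\<psi> u x) (dir_deriv (d\<psi> v) x w)))) (at x)"
  unfolding along_d\<psi>
  by (rule has_derivative_add[OF frechet_derivative_works[THEN iffD1, OF diff_dd\<psi>[OF x]]
      has_derivative_bilinear_field[OF target.christoffel_bilinear source.open_S x into
        target.christoffel_differentiable[OF target_point[OF x]] diff_\<psi>[OF x] diff_d\<psi>[OF x] diff_d\<psi>[OF x]]])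

text \<open>Third and second derivatives of \<open>\<psi>\<close> cancel in the commutator because
  the order of differentiation does not matter; what survives is the Christoffel expression for the
  curvature of the target.\<close>

lemma along_curvature:
  assumes x: "x \<in> S"
  shows "along x u (\<lambda>y. along y v (d\<psi> w)) - along x v (\<lambda>y. along y u (d\<psi> w)) =
    curvature H (\<psi> x) (d\<psi> u x) (d\<psi> v x) (d\<psi> w x)"
proof -
  let ?C = "christoffel H (\<psi> x)"
  have lin: "linear (?C v)" for v
    using target.christoffel_bilinear[OF target_point[OF x]] by (auto simp: bilinear_def)
  have third: "dir_deriv (\<lambda>y. dir_deriv (d\<psi> w) y v) x u = dir_deriv (\<lambda>y. dir_deriv (d\<psi> w) y u) x v"
    by (rule dir_deriv_commute[OF source.open_S x smooth_on_dir_deriv[OF smooth]])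
  have second: "dir_deriv (d\<psi> v) x u = dir_deriv (d\<psi> u) x v"
    by (rule dir_deriv_commute[OF source.open_S x smooth])
  have A: "along x u (\<lambda>y. along y v (d\<psi> w)) = dir_deriv (\<lambda>y. dir_deriv (d\<psi> w) y v) x u +
      (dir_deriv (\<lambda>y. christoffel H y (d\<psi> v x) (d\<psi> w x)) (\<psi> x) (d\<psi> u x) +
       ?C (dir_deriv (d\<psi> v) x u) (d\<psi> w x) + ?C (d\<psi> v x) (dir_deriv (d\<psi> w) x u)) +
      (?C (d\<psi> u x) (dir_deriv (d\<psi> w) x v) + ?C (d\<psi> u x) (?C (d\<psi> v x) (d\<psi> w x)))" for u v
    by (subst covariant_derivative_along_def)
      (simp add: frechet_derivative_eqI[OF along_d\<psi>_has_derivative[OF x, unfolded along_d\<psi>]]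
        along_d\<psi> linear_add[OF lin])
  show ?thesis
    unfolding A[of u v] A[of v u] third second curvature_def target.covariant_derivative_const
    by (simp add: covariant_derivative_def)
qed

text \<open>Split \<open>along y v (d\<psi> w)\<close> into tangential and normal parts. Paired with
  \<open>d\<psi> z\<close>, the derivative of the tangential part gives the curvature of the source.
  The normal part is orthogonal to \<open>d\<psi> z\<close>; differentiating this orthogonality
  moves the derivative onto \<open>d\<psi> z\<close> and leaves a product of second fundamental
  forms with a minus sign.\<close>

theorem gauss_equation:
  assumes x: "x \<in> S"
  shows "G x (curvature G x u v w) z =
    H (\<psi> x) (curvature H (\<psi> x) (d\<psi> u x) (d\<psi> v x) (d\<psi> w x)) (d\<psi> z x)
    + H (\<psi> x) (sff x v w) (sff x u z) - H (\<psi> x) (sff x u w) (sff x v z)"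
proof -
  interpret f: inner_form "H (\<psi> x)" by (rule target.form[OF target_point[OF x]])
  have along_part: "H (\<psi> x) (along x u (\<lambda>y. along y v (d\<psi> w))) (d\<psi> z x) =
      G x (covariant_derivative G x u (\<lambda>y. christoffel G y v w)) z - H (\<psi> x) (sff x v w) (sff x u z)"
    for u v
  proof -
    note \<Gamma> = source.christoffel_differentiable[OF x, of v w]
    have dA: "(\<lambda>y. along y v (d\<psi> w)) differentiable (at x)"
      using along_d\<psi>_has_derivative[OF x] differentiable_def by blast
    have dh: "(\<lambda>y. sff y v w) differentiable (at x)"
      unfolding second_fundamental_form_eq
      by (intro differentiable_diff dA along_tangent(2)[OF x \<Gamma>])
    have "dir_deriv (\<lambda>y. H (\<psi> y) (sff y v w) (d\<psi> z y)) x u = dir_deriv (\<lambda>y. 0) x u"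
      by (rule frechet_derivative_transform_within_open[THEN fun_cong, symmetric, OF _ source.open_S x])
        (auto simp: second_fundamental_form_normal)
    then have N: "H (\<psi> x) (along x u (\<lambda>y. sff y v w)) (d\<psi> z x) =
        - H (\<psi> x) (sff x v w) (along x u (d\<psi> z))"
      using along_metric[OF x dh diff_d\<psi>[OF x]] by simp
    have N': "H (\<psi> x) (sff x v w) (along x u (d\<psi> z)) = H (\<psi> x) (sff x v w) (sff x u z)"
      using second_fundamental_form_normal[OF x, of v w "christoffel G x u z"]
      by (simp add: second_fundamental_form_eq[of x u z] f.form_simps)
    have "along x u (\<lambda>y. along y v (d\<psi> w)) =
        along x u (\<lambda>y. dir_deriv \<psi> y (christoffel G y v w)) + along x u (\<lambda>y. sff y v w)"
    proof -
      have lin: "linear (christoffel H (\<psi> x) a)" for a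
        using target.christoffel_bilinear[OF target_point[OF x]] by (auto simp: bilinear_def)
      have "dir_deriv (\<lambda>y. sff y v w) x u = dir_deriv (\<lambda>y. along y v (d\<psi> w)) x u -
          dir_deriv (\<lambda>y. dir_deriv \<psi> y (christoffel G y v w)) x u"
        unfolding second_fundamental_form_eq
        by (subst frechet_derivative_eqI[OF has_derivative_diff[OF
            frechet_derivative_works[THEN iffD1, OF dA]
            frechet_derivative_works[THEN iffD1, OF along_tangent(2)[OF x \<Gamma>]]]]) simp
      then show ?thesis
        unfolding covariant_derivative_along_def[of H \<psi> x u]
        by (simp add: second_fundamental_form_eq linear_diff[OF lin])
    qed
    also have "along x u (\<lambda>y. dir_deriv \<psi> y (christoffel G y v w)) =
        dir_deriv \<psi> x (covariant_derivative G x u (\<lambda>y. christoffel G y v w)) + sff x u (christoffel G x v w)"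
      by (rule along_tangent(1)[OF x \<Gamma>])
    finally show ?thesis
      using N N' by (simp add: f.form_simps second_fundamental_form_normal[OF x] isometric[OF x])
  qed
  interpret g: inner_form "G x" by (rule source.form[OF x])
  show ?thesis
    unfolding along_curvature[OF x, symmetric] f.form_simps along_part
    by (simp add: curvature_def source.covariant_derivative_const g.form_simps)
qed

end

section \<open>Orthonormal bases and sectional curvature bounds\<close>

context inner_form
begin

abbreviation orthonormal :: "('e \<Rightarrow> 'e) \<Rightarrow> bool" where
  "orthonormal e \<equiv> \<forall>a\<in>Basis. \<forall>b\<in>Basis. q (e a) (e b) = (if a = b then 1 else 0)"

text \<open>That the frame spans follows by a dimension count: it is indexed by
  \<open>Basis\<close>, and orthonormality makes the coordinate map \<open>L\<close>
  injective.\<close>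

lemma orthonormal_expansion:
  assumes e: "orthonormal e"
  shows "v = (\<Sum>a\<in>Basis. q v (e a) *\<^sub>R e a)"
proof -
  define L where "L = (\<lambda>c::'e. \<Sum>a\<in>Basis. (c \<bullet> a) *\<^sub>R e a)"
  have lin: "linear L"
    unfolding L_def by (intro linear_compose_sum linearI ballI) (auto simp: inner_add_left scaleR_add_left)
  have coeff: "q (L c) (e a) = c \<bullet> a" if "a \<in> Basis" for c a
  proof -
    have "q (L c) (e a) = (\<Sum>b\<in>Basis. (c \<bullet> b) * (if b = a then 1 else 0))"
      unfolding L_def form_sum form_simps by (intro sum.cong) (use e that in auto)
    also have "\<dots> = (\<Sum>b\<in>Basis. if b = a then c \<bullet> b else 0)" by (intro sum.cong) auto
    finally show ?thesis using that by simp
  qed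
  have "inj L"
  proof (subst linear_injective_0[OF lin], intro allI impI)
    fix c assume "L c = 0"
    then have "c \<bullet> a = 0" if "a \<in> Basis" for a using coeff[OF that, of c] by (simp add: form_simps)
    then show "c = 0" using euclidean_eqI[of c 0] by simp
  qed
  then have "surj L" using linear_injective_imp_surjective[OF lin] by blast
  then obtain c where c: "v = L c" by (rule surjE)
  have "L c = (\<Sum>a\<in>Basis. q (L c) (e a) *\<^sub>R e a)"
    unfolding fun_cong[OF L_def, of c] by (intro sum.cong refl) (simp add: coeff[unfolded L_def])
  then show ?thesis by (simp only: c)
qed

lemma parseval:
  assumes "orthonormal e" shows "(\<Sum>a\<in>Basis. q u (e a) * q v (e a)) = q u v"
proof -
  have "q u v = q u (\<Sum>a\<in>Basis. q v (e a) *\<^sub>R e a)"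
    by (rule arg_cong[OF orthonormal_expansion[OF assms]])
  then show ?thesis by (simp add: form_sum form_simps mult.commute)
qed

text \<open>Serves to pass from a given frame to one adapted to the product. The coefficients of the
  change of frame form an orthogonal matrix, which \<open>parseval\<close> expresses.\<close>

lemma trace_orthonormal:
  assumes e: "orthonormal e" and e': "orthonormal e'" and \<beta>: "bilinear \<beta>"
  shows "(\<Sum>a\<in>Basis. \<beta> (e a) (e a)) = (\<Sum>a\<in>Basis. \<beta> (e' a) (e' a))"
proof -
  have lin: "linear (\<beta> u)" "linear (\<lambda>u. \<beta> u v)" for u v using \<beta> by (auto simp: bilinear_def)
  have ex: "\<beta> u u = (\<Sum>c\<in>Basis. \<Sum>d\<in>Basis. (q u (e' c) * q u (e' d)) *\<^sub>R \<beta> (e' c) (e' d))" for u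
  proof -
    have E1: "\<beta> u v = (\<Sum>c\<in>Basis. q u (e' c) *\<^sub>R \<beta> (e' c) v)" for v
      using arg_cong[OF orthonormal_expansion[OF e', of u], of "\<lambda>u. \<beta> u v"]
      by (simp add: linear_sum[OF lin(2)] linear_scale[OF lin(2)])
    have E2: "\<beta> w u = (\<Sum>d\<in>Basis. q u (e' d) *\<^sub>R \<beta> w (e' d))" for w
      using arg_cong[OF orthonormal_expansion[OF e', of u], of "\<beta> w"]
      by (simp add: linear_sum[OF lin(1)] linear_scale[OF lin(1)])
    have "\<beta> u u = (\<Sum>c\<in>Basis. q u (e' c) *\<^sub>R \<beta> (e' c) u)" by (rule E1)
    also have "\<dots> = (\<Sum>c\<in>Basis. q u (e' c) *\<^sub>R (\<Sum>d\<in>Basis. q u (e' d) *\<^sub>R \<beta> (e' c) (e' d)))"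
      by (intro sum.cong refl arg_cong[OF E2])
    finally show ?thesis by (simp add: scaleR_sum_right)
  qed
  have "(\<Sum>a\<in>Basis. \<beta> (e a) (e a)) =
      (\<Sum>c\<in>Basis. \<Sum>d\<in>Basis. \<Sum>a\<in>Basis. (q (e a) (e' c) * q (e a) (e' d)) *\<^sub>R \<beta> (e' c) (e' d))"
  proof -
    have "(\<Sum>a\<in>Basis. \<beta> (e a) (e a)) =
        (\<Sum>a\<in>Basis. \<Sum>c\<in>Basis. \<Sum>d\<in>Basis. (q (e a) (e' c) * q (e a) (e' d)) *\<^sub>R \<beta> (e' c) (e' d))"
      by (intro sum.cong refl ex)
    also have "\<dots> = (\<Sum>c\<in>Basis. \<Sum>a\<in>Basis. \<Sum>d\<in>Basis. (q (e a) (e' c) * q (e a) (e' d)) *\<^sub>R \<beta> (e' c) (e' d))"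
      by (rule sum.swap)
    also have "\<dots> = (\<Sum>c\<in>Basis. \<Sum>d\<in>Basis. \<Sum>a\<in>Basis. (q (e a) (e' c) * q (e a) (e' d)) *\<^sub>R \<beta> (e' c) (e' d))"
      by (rule sum.cong[OF refl], rule sum.swap)
    finally show ?thesis .
  qed
  also have "\<dots> = (\<Sum>c\<in>Basis. \<Sum>d\<in>Basis. q (e' c) (e' d) *\<^sub>R \<beta> (e' c) (e' d))"
    by (simp add: parseval[OF e, symmetric, of "e' _" "e' _"] scaleR_sum_left sym[of "e _" "e' _"])
  also have "\<dots> = (\<Sum>c\<in>Basis. \<Sum>d\<in>Basis. if d = c then \<beta> (e' c) (e' c) else 0)"
    by (intro sum.cong refl) (use e' in auto)
  finally show ?thesis by simp
qed

text \<open>Instead of Gram-Schmidt, a dimension argument: \<open>L\<close> maps into the span of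
  \<open>A\<close>, so it misses \<open>c\<close> and has a nonzero kernel vector, which is
  orthogonal to the vectors already chosen.\<close>

lemma exists_orthonormal: "\<exists>e. orthonormal e"
proof -
  have "\<exists>e. \<forall>a\<in>A. \<forall>b\<in>A. q (e a) (e b) = (if a = b then 1 else 0)"
    if "finite A" "A \<subseteq> Basis" for A :: "'e set"
    using that
  proof (induction A)
    case empty then show ?case by simp
  next
    case (insert c A)
    then obtain e where e: "\<forall>a\<in>A. \<forall>b\<in>A. q (e a) (e b) = (if a = b then 1 else 0)" by auto
    define L where "L = (\<lambda>v. \<Sum>a\<in>A. q v (e a) *\<^sub>R a)"
    have lin: "linear L"
      unfolding L_def by (intro linear_compose_sum linearI ballI) (auto simp: form_simps scaleR_add_left)
    have comp: "L v \<bullet> b = (if b \<in> A then q v (e b) else 0)" if "b \<in> Basis" for v b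
    proof -
      have "L v \<bullet> b = (\<Sum>a\<in>A. if a = b then q v (e a) else 0)"
        unfolding L_def inner_sum_left
        by (intro sum.cong) (use insert.prems that in \<open>auto simp: inner_Basis\<close>)
      then show ?thesis using insert.hyps(1) by simp
    qed
    have "\<not> surj L"
    proof
      assume "surj L"
      then obtain v where "c = L v" by (rule surjE)
      then show False using comp[of c v] insert by auto
    qed
    then have "\<not> inj L" using linear_injective_imp_surjective[OF lin] by blast
    then obtain v where v: "v \<noteq> 0" "L v = 0" using linear_injective_0[OF lin] by blast
    have qv: "q v (e a) = 0" "q (e a) v = 0" if "a \<in> A" for a
      using comp[of a v] v that insert.prems sym[of v "e a"] by auto
    define w where "w = (1 / sqrt (q v v)) *\<^sub>R v"
    have w: "q w w = 1" using pos[OF v(1)] by (simp add: w_def form_simps)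
    have "\<forall>a\<in>insert c A. \<forall>b\<in>insert c A. q ((e(c := w)) a) ((e(c := w)) b) = (if a = b then 1 else 0)"
      using e w qv insert.hyps(2) by (auto simp: w_def form_simps)
    then show ?case by blast
  qed
  from this[OF finite_Basis] show ?thesis by auto
qed

section \<open>Quadratic estimates behind the two bounds\<close>

lemma form_sum_sum_le:
  assumes "finite I"
  shows "q (sum y I) (sum y I) \<le> real (card I) * (\<Sum>a\<in>I. q (y a) (y a))"
proof -
  \<comment> \<open>Cauchy-Schwarz follows by summing this inequality over all pairs of
    indices.\<close>
  have "q u v \<le> (q u u + q v v) / 2" for u v
    using nonneg[of "u - v"] sym[of u v] by (simp add: form_simps)
  then have "q (sum y I) (sum y I) \<le> (\<Sum>a\<in>I. \<Sum>b\<in>I. (q (y a) (y a) + q (y b) (y b)) / 2)"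
    unfolding form_sum by (subst sum.swap) (intro sum_mono, simp)
  also have "\<dots> = real (card I) * (\<Sum>a\<in>I. q (y a) (y a))"
    by (simp add: add_divide_distrib sum.distrib sum_divide_distrib[symmetric] sum_distrib_left[symmetric])
  finally show ?thesis .
qed

text \<open>Merging \<open>p b b\<close> and \<open>p c c\<close> into one vector leaves \<open>card I - 1\<close> diagonal vectors with unchanged sum, to
  which the Cauchy-Schwarz inequality applies.\<close>

lemma chen_lower:
  assumes I: "finite I" "b \<in> I" "c \<in> I" "b \<noteq> c" and p: "\<And>a a'. p a a' = p a' a"
  shows "(q (\<Sum>a\<in>I. p a a) (\<Sum>a\<in>I. p a a) / (real (card I) - 1) -
      (\<Sum>a\<in>I. \<Sum>a'\<in>I. q (p a a') (p a a'))) / 2 \<le>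
    q (p b b) (p c c) - q (p b c) (p b c)"
proof -
  let ?N = "\<Sum>a\<in>I. \<Sum>a'\<in>I. q (p a a') (p a a')" and ?D = "\<Sum>a\<in>I. q (p a a) (p a a)"
  let ?T = "\<Sum>a\<in>I. p a a"
  define y where "y a = (if a = b then p b b + p c c else p a a)" for a
  let ?I = "I - {c}" and ?I' = "I - {c} - {b}"
  have bI: "finite ?I" "b \<in> ?I" using I by auto
  note split = sum.remove[OF I(1,3)] and split' = sum.remove[OF bI]
  have "sum y ?I = ?T"
    unfolding split split' by (simp add: y_def add_ac)
  moreover have "(\<Sum>a\<in>?I. q (y a) (y a)) = ?D + 2 * q (p b b) (p c c)"
    unfolding split split' using sym[of "p b b" "p c c"] by (simp add: y_def form_simps)
  \<comment> \<open>Makes \<open>card I - 1\<close> positive, as the division below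
    requires.\<close>
  moreover have "card {b, c} \<le> card I" by (rule card_mono) (use I in auto)
  moreover have "card ?I = card I - 1" using I by simp
  ultimately have 1: "q ?T ?T / (real (card I) - 1) \<le> ?D + 2 * q (p b b) (p c c)"
    using form_sum_sum_le[of ?I y] I(1,4) by (simp add: divide_le_eq of_nat_diff mult.commute)
  \<comment> \<open>The diagonal and the two positions \<open>(b, c)\<close> and
    \<open>(c, b)\<close> are distinct entries of the square array; the others contribute
    nonnegative terms.\<close>
  have "?D + 2 * q (p b c) (p b c) \<le> ?N"
  proof -
    let ?f = "\<lambda>(a, a'). q (p a a') (p a a')"
    let ?d = "(\<lambda>a. (a, a)) ` I"
    have "sum ?f (?d \<union> {(b, c), (c, b)}) = sum ?f ?d + sum ?f {(b, c), (c, b)}"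
      by (rule sum.union_disjoint) (use I in auto)
    also have "sum ?f ?d = ?D" by (subst sum.reindex) (auto simp: inj_on_def)
    also have "sum ?f {(b, c), (c, b)} = 2 * q (p b c) (p b c)" using I p[of b c] by simp
    finally have "?D + 2 * q (p b c) (p b c) = sum ?f (?d \<union> {(b, c), (c, b)})" by simp
    also have "\<dots> \<le> sum ?f (I \<times> I)"
      by (rule sum_mono2) (use I in \<open>auto simp: nonneg\<close>)
    finally show ?thesis by (simp add: sum.cartesian_product)
  qed
  then show ?thesis using 1 by simp
qed

lemma chen_upper:
  "(\<Sum>a\<in>I. \<Sum>b\<in>K. q (p a a) (p b b) - q (p a b) (p a b)) \<le>
    q ((\<Sum>a\<in>I. p a a) + (\<Sum>b\<in>K. p b b)) ((\<Sum>a\<in>I. p a a) + (\<Sum>b\<in>K. p b b)) / 4"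
proof -
  let ?S = "\<Sum>a\<in>I. p a a" and ?T = "\<Sum>b\<in>K. p b b"
  have "(\<Sum>a\<in>I. \<Sum>b\<in>K. q (p a a) (p b b) - q (p a b) (p a b)) \<le> (\<Sum>a\<in>I. \<Sum>b\<in>K. q (p a a) (p b b))"
    by (intro sum_mono) (simp add: nonneg)
  also have "\<dots> = q ?S ?T" unfolding form_sum by (rule sum.swap)
  also have "\<dots> \<le> q (?S + ?T) (?S + ?T) / 4"
    using nonneg[of "?S - ?T"] sym[of ?S ?T] by (simp add: form_simps)
  finally show ?thesis .
qed

lemma bessel_three:
  assumes "q s1 s1 = 1" "q s2 s2 = 1" "q s3 s3 = 1" "q s1 s2 = 0" "q s1 s3 = 0" "q s2 s3 = 0"
  shows "(q s1 x)\<^sup>2 + (q s2 x)\<^sup>2 + (q s3 x)\<^sup>2 \<le> q x x"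
proof -
  have "0 \<le> q (x - q s1 x *\<^sub>R s1 - q s2 x *\<^sub>R s2 - q s3 x *\<^sub>R s3)
    (x - q s1 x *\<^sub>R s1 - q s2 x *\<^sub>R s2 - q s3 x *\<^sub>R s3)" by (rule nonneg)
  then show ?thesis
    using assms sym[of x s1] sym[of x s2] sym[of x s3] sym[of s2 s1] sym[of s3 s1] sym[of s3 s2]
    by (simp add: form_simps power2_eq_square algebra_simps)
qed

end

text \<open>For a unit vector \<open>X\<close>, the vectors \<open>J\<^sub>\<alpha> X\<close> are orthonormal, and so are the \<open>J\<^sub>\<alpha> J X\<close>, where the operators
  \<open>J\<^sub>\<alpha> J\<close> are symmetric; everything follows from Bessel's inequality for these triples.\<close>

lemma grassmannian_sectional_bounds:
  fixes q :: "complex^2^'k::finite \<Rightarrow> complex^2^'k \<Rightarrow> real"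
  assumes q: "inner_form q"
    and JJ: "\<And>X Y. q (cpx_J X) (cpx_J Y) = q X Y"
    and qq: "\<And>X Y \<alpha>. \<alpha> \<in> {1..3} \<Longrightarrow> q (quat_J \<alpha> X) (quat_J \<alpha> Y) = q X Y"
    and X: "q X X = 1" and Y: "q Y Y = 1" and XY: "q X Y = 0"
  shows "- 1 \<le> q (grassmannian_curvature q X Y Y) X" "q (grassmannian_curvature q X Y Y) X \<le> 8"
proof -
  interpret inner_form q by (rule q)
  let ?J = "cpx_J :: complex^2^'k \<Rightarrow> _" and ?j = "quat_J :: _ \<Rightarrow> complex^2^'k \<Rightarrow> _"
  have quat_sq: "?j \<alpha> (?j \<alpha> Z) = - Z" if "\<alpha> \<in> {1..3}" for \<alpha> Z
    using that quat_relations(3-5)[of Z] by (auto simp: numeral_eq_Suc le_Suc_eq Suc_le_eq)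
  have skewJ: "q (?J Z) W = - q Z (?J W)" for Z W
    using JJ[of Z "?J W"] by (simp add: quat_relations form_simps)
  have skewj: "q (?j \<alpha> Z) W = - q Z (?j \<alpha> W)" if "\<alpha> \<in> {1..3}" for \<alpha> Z W
    using qq[OF that, of Z "?j \<alpha> W"] by (simp add: quat_sq[OF that] form_simps)
  have J0: "q (?J Z) Z = 0" for Z using skewJ[of Z Z] sym[of Z "?J Z"] by simp
  have j0: "q (?j \<alpha> Z) Z = 0" if "\<alpha> \<in> {1..3}" for \<alpha> Z
    using skewj[OF that, of Z Z] sym[of Z "?j \<alpha> Z"] by simp
  have 123: "(1::nat) \<in> {1..3}" "(2::nat) \<in> {1..3}" "(3::nat) \<in> {1..3}" by auto
  have j_orth: "q (?j 1 Z) (?j 2 Z) = 0" "q (?j 1 Z) (?j 3 Z) = 0" "q (?j 2 Z) (?j 3 Z) = 0" for Z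
  proof -
    show "q (?j 1 Z) (?j 2 Z) = 0"
      using skewj[OF 123(1), of Z "?j 2 Z"] j0[OF 123(3), of Z] sym[of Z] by (simp add: quat_relations del: One_nat_def)
    have "?j 1 (?j 3 Z) = - ?j 2 Z"
      by (simp add: quat_relations(1)[symmetric] quat_relations(3) del: One_nat_def)
    then show "q (?j 1 Z) (?j 3 Z) = 0"
      using skewj[OF 123(1), of Z "?j 3 Z"] j0[OF 123(2), of Z] sym[of Z] by (simp add: form_simps del: One_nat_def)
    have "- ?j 3 Z = ?j 2 (?j 1 Z)" by (simp add: quat_relations del: One_nat_def)
    then have "q (?j 2 Z) (?j 3 Z) = - q (?j 2 Z) (?j 2 (?j 1 Z))"
      by (metis form_simps(8) minus_minus)
    also have "\<dots> = 0" using qq[OF 123(2), of Z "?j 1 Z"] j0[OF 123(1), of Z] sym[of Z] by (simp del: One_nat_def)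
    finally show "q (?j 2 Z) (?j 3 Z) = 0" .
  qed
  have symS: "q (?j \<alpha> (?J Z)) W = q (?j \<alpha> (?J W)) Z" if "\<alpha> \<in> {1..3}" for \<alpha> Z W
    by (simp add: skewj[OF that] skewJ quat_relations(7) sym[of Z])
  have bj: "(q (?j 1 Z) W)\<^sup>2 + (q (?j 2 Z) W)\<^sup>2 + (q (?j 3 Z) W)\<^sup>2 \<le> 1" if "q Z Z = 1" "q W W = 1" for Z W
    using bessel_three[of "?j 1 Z" "?j 2 Z" "?j 3 Z" W] that j_orth qq 123 by (simp del: One_nat_def)
  have bS: "(q (?j 1 (?J Z)) W)\<^sup>2 + (q (?j 2 (?J Z)) W)\<^sup>2 + (q (?j 3 (?J Z)) W)\<^sup>2 \<le> 1"
    if "q Z Z = 1" "q W W = 1" for Z W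
    using bj[of "?J Z" W] that JJ by simp
  have bJ: "(q (?J X) Y)\<^sup>2 \<le> 1"
  proof -
    have "0 \<le> q (Y - q (?J X) Y *\<^sub>R ?J X) (Y - q (?J X) Y *\<^sub>R ?J X)" by (rule nonneg)
    then show ?thesis
      using X Y JJ[of X X] sym[of Y "?J X"] by (simp add: form_simps power2_eq_square)
  qed
  have set3: "{1..3} = {1::nat, 2, 3}" by auto
  \<comment> \<open>Skewness makes the simple and the doubled term of \<open>cpx_J\<close> combine
    into three times a square, and likewise for each \<open>quat_J \<alpha>\<close>. Their products
    with \<open>cpx_J\<close> are symmetric and give diagonal products minus squares.\<close>
  have K: "q (grassmannian_curvature q X Y Y) X = 1 + 3 * (q (?J X) Y)\<^sup>2 +
      3 * ((q (?j 1 X) Y)\<^sup>2 + (q (?j 2 X) Y)\<^sup>2 + (q (?j 3 X) Y)\<^sup>2) +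
      (q (?j 1 (?J Y)) Y * q (?j 1 (?J X)) X + q (?j 2 (?J Y)) Y * q (?j 2 (?J X)) X +
       q (?j 3 (?J Y)) Y * q (?j 3 (?J X)) X) -
      ((q (?j 1 (?J X)) Y)\<^sup>2 + (q (?j 2 (?J X)) Y)\<^sup>2 + (q (?j 3 (?J X)) Y)\<^sup>2)"
  proof -
    have flip: "q (?J Y) X = - q (?J X) Y" using skewJ[of Y X] sym[of Y "?J X"] by simp
    have flip': "q (?j \<alpha> Y) X = - q (?j \<alpha> X) Y" if "\<alpha> \<in> {1..3}" for \<alpha>
      using skewj[OF that, of Y X] sym[of Y "?j \<alpha> X"] by simp
    show ?thesis
      unfolding grassmannian_curvature_def set3
      using X Y XY sym[of Y X] J0 j0 123
      by (simp add: form_simps flip flip' symS[of _ Y X] power2_eq_square)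
  qed
  have am: "a * b \<le> (a\<^sup>2 + b\<^sup>2) / 2" "- (a * b) \<le> (a\<^sup>2 + b\<^sup>2) / 2" for a b :: real
    using sum_squares_bound[of a b] sum_squares_bound[of a "- b"] by auto
  \<comment> \<open>Each product is at most the mean of two squares, and Bessel's inequality bounds
    the sum of the squares by 1, for \<open>X\<close> and for \<open>Y\<close>.\<close>
  have mixed: "\<bar>q (?j 1 (?J Y)) Y * q (?j 1 (?J X)) X + q (?j 2 (?J Y)) Y * q (?j 2 (?J X)) X +
       q (?j 3 (?J Y)) Y * q (?j 3 (?J X)) X\<bar> \<le> 1"
    using am[of "q (?j 1 (?J Y)) Y" "q (?j 1 (?J X)) X"] am[of "q (?j 2 (?J Y)) Y" "q (?j 2 (?J X)) X"]
      am[of "q (?j 3 (?J Y)) Y" "q (?j 3 (?J X)) X"] bS[OF X X] bS[OF Y Y]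
    unfolding abs_le_iff by argo
  \<comment> \<open>Here -1 is 1 - 1 - 1: the constant term, the mixed sum and the last sum of
    squares; the terms with factor 3 are dropped.\<close>
  show "- 1 \<le> q (grassmannian_curvature q X Y Y) X"
    unfolding K using mixed bS[OF X Y] zero_le_power2[of "q (?J X) Y"]
      zero_le_power2[of "q (?j 1 X) Y"] zero_le_power2[of "q (?j 2 X) Y"]
      zero_le_power2[of "q (?j 3 X) Y"]
    unfolding abs_le_iff by argo
  \<comment> \<open>Here 8 is 1 + 3 + 3 + 1, with the last sum of squares dropped.\<close>
  show "q (grassmannian_curvature q X Y Y) X \<le> 8"
    unfolding K using mixed bJ bj[OF X Y] zero_le_power2[of "q (?j 1 (?J X)) Y"]
      zero_le_power2[of "q (?j 2 (?J X)) Y"] zero_le_power2[of "q (?j 3 (?J X)) Y"]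
    unfolding abs_le_iff by argo
qed

section \<open>Charts of the Grassmannian\<close>

definition hdot :: "complex^'n::finite \<Rightarrow> complex^'n \<Rightarrow> complex" where
  "hdot a b = (\<Sum>i\<in>UNIV. a $ i * cnj (b $ i))"

lemma hdot_add_diff:
  "hdot (a + b) c = hdot a c + hdot b c" "hdot c (a + b) = hdot c a + hdot c b"
  "hdot (a - b) c = hdot a c - hdot b c" "hdot c (a - b) = hdot c a - hdot c b"
  by (simp_all add: hdot_def ring_distribs sum.distrib sum_subtractf)

lemma hdot_scale: "hdot (z *s a) b = z * hdot a b" "hdot a (z *s b) = cnj z * hdot a b"
  by (simp_all add: hdot_def sum_distrib_left mult_ac)

lemmas hdot_simps = hdot_add_diff hdot_scale

lemma hdot_commute: "hdot b a = cnj (hdot a b)"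
  by (simp add: hdot_def mult.commute)

lemma hdot_self: "hdot a a = of_real (\<Sum>i\<in>UNIV. (cmod (a $ i))\<^sup>2)"
  by (simp add: hdot_def complex_norm_square[symmetric] del: of_real_power)

lemma hdot_eq_0_iff: "hdot a a = 0 \<longleftrightarrow> a = 0"
proof -
  have "hdot a a = 0 \<longleftrightarrow> (\<Sum>i\<in>UNIV. (cmod (a $ i))\<^sup>2) = 0" by (simp only: hdot_self of_real_eq_0_iff)
  also have "\<dots> \<longleftrightarrow> a = 0" by (simp add: sum_nonneg_eq_0_iff vec_eq_iff)
  finally show ?thesis .
qed

lemma normalize_hdot:
  assumes "a \<noteq> 0"
  obtains r :: complex where "r \<noteq> 0" "hdot (r *s a) (r *s a) = 1"
proof -
  define s where "s = (\<Sum>i\<in>UNIV. (cmod (a $ i))\<^sup>2)"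
  have h: "hdot a a = of_real s" by (simp only: hdot_self s_def)
  have "s \<ge> 0" by (simp add: s_def sum_nonneg)
  moreover have "s \<noteq> 0" using assms hdot_eq_0_iff[of a] h by auto
  ultimately have s: "s > 0" by simp
  show thesis
  proof (rule that[of "of_real (1 / sqrt s)"])
    show "complex_of_real (1 / sqrt s) \<noteq> 0" using s by simp
    have "hdot (of_real (1 / sqrt s) *s a) (of_real (1 / sqrt s) *s a) = of_real (1 / sqrt s * (1 / sqrt s) * s)"
      by (simp only: hdot_simps h complex_cnj_complex_of_real of_real_mult mult.assoc)
    then show "hdot (of_real (1 / sqrt s) *s a) (of_real (1 / sqrt s) *s a) = 1"
      using s by (simp add: field_simps)
  qed
qed

text \<open>Provides the phase of \<open>z\<close>. A reflection can carry \<open>a\<close> to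
  \<open>b\<close> only if their Hermitian product is real, so targets are first multiplied by such
  a \<open>c\<close>.\<close>

lemma phase_exists:
  fixes z :: complex
  obtains c where "c * cnj c = 1" "cnj c * z = cnj (cnj c * z)"
proof (cases "z = 0")
  case True then show thesis using that[of 1] by simp
next
  case False
  let ?c = "z / of_real (cmod z)"
  have zz: "cnj z * z = of_real (cmod z) * of_real (cmod z)" "z * cnj z = of_real (cmod z) * of_real (cmod z)"
    by (simp_all add: complex_norm_square[symmetric] power2_eq_square mult.commute)
  show thesis
  proof (rule that[of ?c])
    show "?c * cnj ?c = 1" using False zz by (simp add: field_simps)
    show "cnj ?c * z = cnj (cnj ?c * z)" using False zz by (simp add: field_simps)
  qed
qed

definition unitary :: "complex^'n::finite^'n \<Rightarrow> bool" where
  "unitary A \<longleftrightarrow> A ** conj_transpose A = mat 1"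

lemma conj_transpose_mult: "conj_transpose (A ** B) = conj_transpose B ** conj_transpose A"
  by (simp add: conj_transpose_def matrix_matrix_mult_def vec_eq_iff mult.commute)

lemma unitary_mult:
  assumes "unitary A" "unitary B" shows "unitary (A ** B)"
proof -
  have "A ** B ** (conj_transpose B ** conj_transpose A) = A ** (B ** conj_transpose B) ** conj_transpose A"
    by (simp add: matrix_mul_assoc)
  then show ?thesis using assms by (simp add: unitary_def conj_transpose_mult)
qed

lemma unitary_left: "unitary A \<Longrightarrow> conj_transpose A ** A = mat 1"
  unfolding unitary_def by (simp add: matrix_left_right_inverse)

lemma unitary_vector_left: "unitary A \<Longrightarrow> conj_transpose A *v (A *v x) = x"
  using unitary_left[of A] by (simp add: matrix_vector_mul_assoc)

lemma unitary_vector_right: "unitary A \<Longrightarrow> A *v (conj_transpose A *v x) = x"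
  by (simp add: matrix_vector_mul_assoc unitary_def)

lemma hdot_adjoint: "hdot (A *v x) y = hdot x (conj_transpose A *v y)"
proof -
  have "hdot (A *v x) y = (\<Sum>i\<in>UNIV. \<Sum>j\<in>UNIV. A $ i $ j * x $ j * cnj (y $ i))"
    by (simp add: hdot_def matrix_vector_mult_def sum_distrib_right)
  also have "\<dots> = (\<Sum>j\<in>UNIV. \<Sum>i\<in>UNIV. A $ i $ j * x $ j * cnj (y $ i))" by (rule sum.swap)
  also have "\<dots> = hdot x (conj_transpose A *v y)"
    by (simp add: hdot_def matrix_vector_mult_def conj_transpose_def sum_distrib_left mult_ac)
  finally show ?thesis .
qed

lemma conj_transpose_involution [simp]: "conj_transpose (conj_transpose A) = A"
  by (simp add: conj_transpose_def vec_eq_iff)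

definition householder :: "complex^'n::finite \<Rightarrow> complex^'n^'n" where
  "householder v = (\<chi> i j. (if i = j then 1 else 0) - 2 / hdot v v * (v $ i * cnj (v $ j)))"

lemma householder_vector: "householder v *v x = x - (2 * hdot x v / hdot v v) *s v"
proof -
  have "(householder v *v x) $ i = (x - (2 * hdot x v / hdot v v) *s v) $ i" for i
  proof -
    have "(householder v *v x) $ i =
        (\<Sum>j\<in>UNIV. (if i = j then x $ j else 0) - 2 / hdot v v * v $ i * (x $ j * cnj (v $ j)))"
      by (auto simp: householder_def matrix_vector_mult_def left_diff_distrib intro!: sum.cong)
    also have "\<dots> = x $ i - 2 / hdot v v * v $ i * hdot x v"
      by (simp add: sum_subtractf hdot_def[of x v] sum_distrib_left)
    finally show ?thesis by simp
  qed
  then show ?thesis by (simp add: vec_eq_iff)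
qed

lemma conj_transpose_householder: "conj_transpose (householder v) = householder v"
proof -
  have "cnj (hdot v v) = hdot v v" using hdot_commute[of v v] by simp
  then show ?thesis by (simp add: conj_transpose_def householder_def vec_eq_iff mult.commute)
qed

lemma unitary_householder:
  assumes "v \<noteq> 0" shows "unitary (householder v)"
  unfolding unitary_def conj_transpose_householder matrix_eq
proof
  fix x
  have "hdot v v \<noteq> 0" using assms hdot_eq_0_iff by blast
  then show "householder v ** householder v *v x = mat 1 *v x"
    by (simp add: matrix_vector_mul_assoc[symmetric] householder_vector hdot_simps vec_eq_iff field_simps)
qed

text \<open>For distinct vectors, reflect in the hyperplane orthogonal to \<open>v = a - b\<close>:
  equal lengths and a real product give \<open>hdot v v = 2 * hdot a v\<close>, which makes the
  coefficient of \<open>v\<close> equal to 1. The last clause lets two reflections be composed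
  without disturbing a vector already placed.\<close>

lemma unitary_reflection:
  assumes "hdot a a = hdot b b" "hdot a b = hdot b a"
  obtains R where "unitary R" "R *v a = b" "\<And>x. hdot x a = 0 \<Longrightarrow> hdot x b = 0 \<Longrightarrow> R *v x = x"
proof (cases "a = b")
  case True
  have "unitary (mat 1 :: complex^'n^'n)"
    by (auto simp: unitary_def conj_transpose_def mat_def vec_eq_iff matrix_matrix_mult_def
      if_distrib[of "\<lambda>z. z * _"] if_distrib[of cnj] cong: if_cong)
  then show thesis using that[of "mat 1"] True by simp
next
  case False
  let ?v = "a - b"
  have n0: "hdot ?v ?v \<noteq> 0" using False hdot_eq_0_iff[of ?v] by simp
  have "hdot ?v ?v = 2 * hdot a ?v" using assms by (simp add: hdot_simps)
  then have "householder ?v *v a = b"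
    using n0 by (simp add: householder_vector)
  then show thesis
    using that[of "householder ?v"] False unitary_householder[of ?v]
    by (simp add: householder_vector hdot_simps)
qed

lemma det_conj_transpose: "det (conj_transpose A) = cnj (det A)"
proof -
  have "det (conj_transpose A) = det (transpose (conj_transpose A))" by (simp add: det_transpose)
  also have "\<dots> = cnj (det A)"
    by (simp add: det_def transpose_def conj_transpose_def)
  finally show ?thesis .
qed

section \<open>Planes as graphs, and charts centred at a given plane\<close>

lemma graph_plane_zero: "graph_plane (0 :: complex^2^'k::finite) = {v. \<forall>i. v $ Inl i = 0}"
  by (simp add: graph_plane_def)

lemma graph_plane_closed:
  "a \<in> graph_plane Z \<Longrightarrow> b \<in> graph_plane Z \<Longrightarrow> a + b \<in> graph_plane Z"
  "a \<in> graph_plane Z \<Longrightarrow> b \<in> graph_plane Z \<Longrightarrow> a - b \<in> graph_plane Z"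
  "a \<in> graph_plane Z \<Longrightarrow> z *s a \<in> graph_plane Z"
proof -
  show "a \<in> graph_plane Z \<Longrightarrow> b \<in> graph_plane Z \<Longrightarrow> a + b \<in> graph_plane Z"
    "a \<in> graph_plane Z \<Longrightarrow> b \<in> graph_plane Z \<Longrightarrow> a - b \<in> graph_plane Z"
    by (simp_all add: graph_plane_def ring_distribs sum.distrib sum_subtractf)
  show "a \<in> graph_plane Z \<Longrightarrow> z *s a \<in> graph_plane Z"
    by (simp add: graph_plane_def sum_distrib_left mult_ac)
qed

lemma all_sum_2: "(\<forall>x :: 'k + 2. P x) \<longleftrightarrow> (\<forall>i. P (Inl i)) \<and> P (Inr 1) \<and> P (Inr 2)"
  by (simp add: split_sum_all forall_2)

text \<open>An orthonormal basis \<open>p1\<close>, \<open>p2\<close> of the graph comes from its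
  obvious basis \<open>g1\<close>, \<open>g2\<close> by Gram-Schmidt; two reflections carry the
  coordinate vectors to it up to phases, which do not change the plane.\<close>

lemma graph_plane_orbit:
  fixes Z :: "complex^2^'k::finite"
  obtains A where "unitary A" "(\<lambda>v. A *v v) ` graph_plane 0 = graph_plane Z"
proof -
  define e1 :: "complex^('k + 2)" where "e1 = axis (Inr 1) 1"
  define e2 :: "complex^('k + 2)" where "e2 = axis (Inr 2) 1"
  define g1 :: "complex^('k + 2)" where "g1 = (\<chi> s. case s of Inl i \<Rightarrow> Z $ i $ 1 | Inr j \<Rightarrow> if j = 1 then 1 else 0)"
  define g2 :: "complex^('k + 2)" where "g2 = (\<chi> s. case s of Inl i \<Rightarrow> Z $ i $ 2 | Inr j \<Rightarrow> if j = 2 then 1 else 0)"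
  have span0: "v = (v $ Inr 1) *s e1 + (v $ Inr 2) *s e2" if "v \<in> graph_plane 0" for v
    using that by (simp add: vec_eq_iff all_sum_2 graph_plane_zero e1_def e2_def axis_def)
  have spanZ: "v = (v $ Inr 1) *s g1 + (v $ Inr 2) *s g2" if "v \<in> graph_plane Z" for v
    using that by (simp add: vec_eq_iff all_sum_2 graph_plane_def g1_def g2_def sum_2 mult.commute)
  have e: "e1 \<in> graph_plane 0" "e2 \<in> graph_plane 0"
    by (auto simp: graph_plane_zero e1_def e2_def axis_def)
  have g: "g1 \<in> graph_plane Z" "g2 \<in> graph_plane Z"
    by (auto simp: graph_plane_def g1_def g2_def sum_2)
  have hax: "hdot (axis i 1) (axis j 1) = (if i = j then 1 else 0)" for i j :: "'k + 2"
    by (simp add: hdot_def axis_def if_distrib[of cnj] if_distrib[of "\<lambda>z. z * _"] cong: if_cong)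
  have ee: "hdot e1 e1 = 1" "hdot e2 e2 = 1" "hdot e1 e2 = 0" "hdot e2 e1 = 0"
    by (simp_all add: e1_def e2_def hax)
  have "g1 $ Inr 1 = 1" by (simp add: g1_def)
  then have "g1 \<noteq> 0" by auto
  then obtain r1 where r1: "r1 \<noteq> 0" "hdot (r1 *s g1) (r1 *s g1) = 1" by (rule normalize_hdot)
  define p1 where "p1 = r1 *s g1"
  define u2 where "u2 = g2 - hdot g2 p1 *s p1"
  have p1: "p1 \<in> graph_plane Z" "hdot p1 p1 = 1" using g graph_plane_closed r1 by (auto simp: p1_def)
  have u2p1: "hdot u2 p1 = 0" using p1 by (simp add: u2_def hdot_simps)
  have "u2 \<noteq> 0"
  proof
    assume "u2 = 0"
    then have "g2 = (hdot g2 p1 * r1) *s g1" by (simp add: u2_def p1_def)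
    then have "g2 $ Inr 1 = ((hdot g2 p1 * r1) *s g1) $ Inr 1" "g2 $ Inr 2 = ((hdot g2 p1 * r1) *s g1) $ Inr 2"
      by simp_all
    then show False by (simp add: g1_def g2_def)
  qed
  then obtain r2 where r2: "r2 \<noteq> 0" "hdot (r2 *s u2) (r2 *s u2) = 1" by (rule normalize_hdot)
  define p2 where "p2 = r2 *s u2"
  have p2: "p2 \<in> graph_plane Z" "hdot p2 p2 = 1" "hdot p2 p1 = 0"
  proof -
    have "u2 \<in> graph_plane Z" using g p1 by (simp add: u2_def graph_plane_closed)
    then show "p2 \<in> graph_plane Z" by (simp add: p2_def graph_plane_closed)
    show "hdot p2 p2 = 1" using r2 by (simp add: p2_def)
    show "hdot p2 p1 = 0" using u2p1 by (simp add: p2_def hdot_simps)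
  qed
  obtain c1 where c1: "c1 * cnj c1 = 1" "cnj c1 * hdot e1 p1 = cnj (cnj c1 * hdot e1 p1)"
    by (rule phase_exists)
  have "hdot e1 e1 = hdot (c1 *s p1) (c1 *s p1)" "hdot e1 (c1 *s p1) = hdot (c1 *s p1) e1"
    using ee p1 c1 hdot_commute[of p1 e1] mult.commute[of c1 "cnj c1"] by (simp_all add: hdot_simps)
  then obtain R1 where R1: "unitary R1" "R1 *v e1 = c1 *s p1"
    by (rule unitary_reflection)
  \<comment> \<open>\<open>R1\<close> is applied last, so the target of the second reflection is
    pulled back through it; \<open>p2'\<close> is orthogonal to \<open>e1\<close>, hence
    \<open>R2\<close> fixes \<open>e1\<close>.\<close>
  define p2' where "p2' = conj_transpose R1 *v p2"
  have R1p2': "R1 *v p2' = p2" by (simp add: p2'_def unitary_vector_right[OF R1(1)])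
  have pp: "hdot p2' p2' = 1" using p2 by (simp add: p2'_def hdot_adjoint R1p2'[unfolded p2'_def])
  have pe: "hdot p2' e1 = 0" using p2 by (simp add: p2'_def hdot_adjoint R1 hdot_simps)
  obtain c2 where c2: "c2 * cnj c2 = 1" "cnj c2 * hdot e2 p2' = cnj (cnj c2 * hdot e2 p2')"
    by (rule phase_exists)
  have "hdot e2 e2 = hdot (c2 *s p2') (c2 *s p2')" "hdot e2 (c2 *s p2') = hdot (c2 *s p2') e2"
    using ee pp c2 hdot_commute[of p2' e2] mult.commute[of c2 "cnj c2"] by (simp_all add: hdot_simps)
  then obtain R2 where R2: "unitary R2" "R2 *v e2 = c2 *s p2'"
    "\<And>x. hdot x e2 = 0 \<Longrightarrow> hdot x (c2 *s p2') = 0 \<Longrightarrow> R2 *v x = x"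
    by (rule unitary_reflection) blast
  have R2e1: "R2 *v e1 = e1"
    by (rule R2(3)) (use ee pe hdot_commute[of e1 p2'] in \<open>simp_all add: hdot_simps\<close>)
  define A where "A = R1 ** R2"
  have Ae: "A *v e1 = c1 *s p1" "A *v e2 = c2 *s p2"
    by (simp_all add: A_def matrix_vector_mul_assoc[symmetric] R2e1 R1 R2(2) R1p2'
      vector_scalar_commute)
  have Alin: "A *v (a *s e1 + b *s e2) = (a * c1) *s p1 + (b * c2) *s p2" for a b
    by (simp add: matrix_vector_right_distrib vector_scalar_commute Ae)
  have cn: "c1 \<noteq> 0" "c2 \<noteq> 0" using c1 c2 by auto
  have "(\<lambda>v. A *v v) ` graph_plane 0 = graph_plane Z"
  proof
    show "(\<lambda>v. A *v v) ` graph_plane 0 \<subseteq> graph_plane Z"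
    proof
      fix w assume "w \<in> (\<lambda>v. A *v v) ` graph_plane 0"
      then obtain v where v: "v \<in> graph_plane 0" "w = A *v v" by blast
      have "w = A *v ((v $ Inr 1) *s e1 + (v $ Inr 2) *s e2)"
        unfolding v(2) by (rule arg_cong[OF span0[OF v(1)]])
      then show "w \<in> graph_plane Z"
        using p1 p2 by (simp add: Alin graph_plane_closed)
    qed
    show "graph_plane Z \<subseteq> (\<lambda>v. A *v v) ` graph_plane 0"
    proof
      fix w assume w: "w \<in> graph_plane Z"
      have G1: "g1 = (1 / r1) *s p1" using r1 by (simp add: p1_def)
      have G2: "g2 = (1 / r2) *s p2 + hdot g2 p1 *s p1" using r2 by (simp add: p2_def u2_def)
      define a where "a = (w $ Inr 1 / r1 + w $ Inr 2 * hdot g2 p1) / c1"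
      define b where "b = w $ Inr 2 / r2 / c2"
      have "w = (w $ Inr 1) *s g1 + (w $ Inr 2) *s g2" by (rule spanZ[OF w])
      also have "\<dots> = (a * c1) *s p1 + (b * c2) *s p2"
      proof -
        have "a * c1 = w $ Inr 1 / r1 + w $ Inr 2 * hdot g2 p1" "b * c2 = w $ Inr 2 / r2"
          using cn by (simp_all add: a_def b_def)
        then show ?thesis by (subst G1, subst (1) G2) (simp add: vec_eq_iff algebra_simps)
      qed
      also have "\<dots> = A *v (a *s e1 + b *s e2)" by (rule Alin[symmetric])
      finally show "w \<in> (\<lambda>v. A *v v) ` graph_plane 0"
        using e by (simp add: graph_plane_closed)
    qed
  qed
  then show thesis using that[of A] unitary_mult R1(1) R2(1) by (auto simp: A_def)
qed

lemma special_unitary_iff: "A \<in> special_unitary \<longleftrightarrow> unitary A \<and> det A = 1"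
  by (simp add: special_unitary_def unitary_def)

lemma grassmannian_simps:
  "indices grassmannian = special_unitary" "dom grassmannian U = UNIV"
  "par grassmannian U Z = (\<lambda>v. U *v v) ` graph_plane Z"
  by (simp_all add: grassmannian_def)

text \<open>\<open>graph_plane_orbit\<close> gives only a unitary matrix, whereas charts are indexed
  by matrices of determinant 1; the determinant is corrected without moving the central
  plane.\<close>

lemma grassmannian_centred_chart:
  fixes Z :: "complex^2^'k::finite"
  assumes U: "U \<in> special_unitary"
  obtains U' where "U' \<in> special_unitary" "par grassmannian U' 0 = par grassmannian U Z"
proof -
  obtain A where A: "unitary A" "(\<lambda>v. A *v v) ` graph_plane 0 = graph_plane Z"
    by (rule graph_plane_orbit)
  define d where "d = det (U ** A)"
  have UA: "unitary (U ** A)" using U A by (simp add: special_unitary_iff unitary_mult)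
  have "det ((U ** A) ** conj_transpose (U ** A)) = 1"
    using UA by (simp add: unitary_def)
  then have d: "d * cnj d = 1" by (simp only: det_mul det_conj_transpose d_def)
  \<comment> \<open>A phase on one of the last two coordinates preserves
    \<open>graph_plane 0\<close> and contributes the inverse \<open>cnj d\<close> of the
    determinant.\<close>
  define D :: "complex^('k + 2)^('k + 2)"
    where "D = (\<chi> i j. if i = j then (if i = Inr 1 then cnj d else 1) else 0)"
  have Dv: "D *v v = (\<chi> i. (if i = Inr 1 then cnj d else 1) * v $ i)" for v
    by (simp add: D_def vec_eq_iff matrix_vector_mult_def if_distrib[of "\<lambda>z. z * _"] cong: if_cong)
  have "conj_transpose D = (\<chi> i j. if i = j then (if i = Inr 1 then d else 1) else 0)"
    by (auto simp: D_def conj_transpose_def vec_eq_iff)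
  then have Dsv: "conj_transpose D *v v = (\<chi> i. (if i = Inr 1 then d else 1) * v $ i)" for v
    by (simp add: vec_eq_iff matrix_vector_mult_def if_distrib[of "\<lambda>z. z * _"] cong: if_cong)
  have unD: "unitary D"
    unfolding unitary_def matrix_eq
    using d by (auto simp: matrix_vector_mul_assoc[symmetric] Dv Dsv vec_eq_iff mult.commute)
  have "det D = (\<Prod>i\<in>UNIV. D $ i $ i)"
    by (rule det_diagonal) (simp add: D_def)
  also have "\<dots> = (\<Prod>i\<in>(UNIV :: ('k + 2) set). if i = Inr 1 then cnj d else 1)"
    by (simp add: D_def)
  also have "\<dots> = cnj d" by simp
  finally have detD: "det D = cnj d" .
  have D0: "(\<lambda>v. D *v v) ` graph_plane 0 = graph_plane 0"
  proof
    show "(\<lambda>v. D *v v) ` graph_plane 0 \<subseteq> graph_plane 0"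
      by (auto simp: graph_plane_zero Dv)
    show "graph_plane 0 \<subseteq> (\<lambda>v. D *v v) ` graph_plane 0"
    proof
      fix w :: "complex^('k + 2)" assume "w \<in> graph_plane 0"
      then have "conj_transpose D *v w \<in> graph_plane 0" by (auto simp: graph_plane_zero Dsv)
      then show "w \<in> (\<lambda>v. D *v v) ` graph_plane 0"
        using unitary_vector_right[OF unD] by (metis imageI)
    qed
  qed
  show thesis
  proof (rule that[of "(U ** A) ** D"])
    show "(U ** A) ** D \<in> special_unitary"
      using UA unD d detD unfolding special_unitary_iff det_mul[of "U ** A"]
      by (simp add: unitary_mult d_def[symmetric])
    have "par grassmannian ((U ** A) ** D) 0 = (\<lambda>v. U *v v) ` (\<lambda>v. A *v v) ` (\<lambda>v. D *v v) ` graph_plane 0"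
      by (simp add: grassmannian_simps image_image matrix_vector_mul_assoc matrix_mul_assoc)
    then show "par grassmannian ((U ** A) ** D) 0 = par grassmannian U Z"
      by (simp add: D0 A grassmannian_simps)
  qed
qed

lemma grassmannian_par_inj:
  fixes Z :: "complex^2^'k::finite"
  assumes U: "U \<in> special_unitary" and eq: "par grassmannian U Z = par grassmannian U Z'"
  shows "Z = Z'"
proof -
  have un: "unitary U" using U by (simp add: special_unitary_iff)
  have "inj ((*v) U)" using unitary_vector_left[OF un] by (metis injI)
  then have g: "graph_plane Z = graph_plane Z'"
    using eq by (simp add: grassmannian_simps inj_image_eq_iff)
  have "Z $ i $ j = Z' $ i $ j" for i j
  proof -
    \<comment> \<open>The vector of the graph lying over the \<open>j\<close>-th coordinate vector;
      column \<open>j\<close> of \<open>Z\<close> can be read off from it.\<close>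
    define v :: "complex^('k + 2)" where "v = (\<chi> s. case s of Inl i \<Rightarrow> Z $ i $ j | Inr l \<Rightarrow> if l = j then 1 else 0)"
    have "v \<in> graph_plane Z"
      by (simp add: graph_plane_def v_def if_distrib[of "\<lambda>z. _ * z"] cong: if_cong)
    then have "v $ Inl i = (\<Sum>l\<in>UNIV. Z' $ i $ l * v $ Inr l)" unfolding g by (simp add: graph_plane_def)
    then show ?thesis by (simp add: v_def if_distrib[of "\<lambda>z. _ * z"] cong: if_cong)
  qed
  then show ?thesis by (simp add: vec_eq_iff)
qed

section \<open>From metric fields to local metrics\<close>

lemma riemannian_metric_patch:
  assumes g: "riemannian_metric M g" and i: "i \<in> indices M" and S: "open S" "S \<subseteq> dom M i"
  shows "riemannian_patch S (g i)"
proof (rule riemannian_patch.intro)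
  show "open S" by (rule S)
  have sm: "smooth_on (dom M i) (\<lambda>x. g i x u v)" for u v
    using g i by (auto simp: riemannian_metric_def)
  fix x assume "x \<in> S"
  then have x: "x \<in> dom M i" using S by blast
  show "inner_form (g i x)"
    using g i x by unfold_locales (auto simp: riemannian_metric_def)
  show "(\<lambda>y. g i y u v) differentiable (at x)" for u v
    by (rule smooth_on_differentiable[OF sm x])
  show "(\<lambda>y. dir_deriv (\<lambda>z. g i z u v) y w) differentiable (at x)" for u v w
    by (rule smooth_on_differentiable[OF smooth_on_dir_deriv[OF sm] x])
qed

lemma grassmannian_metric_patch:
  assumes "normalized_grassmannian_metric g" "U \<in> special_unitary"
  shows "riemannian_patch UNIV (g U)"
proof -
  have "riemannian_metric grassmannian g"
    using assms(1) unfolding normalized_grassmannian_metric_def by blast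
  then show ?thesis
    by (rule riemannian_metric_patch) (use assms(2) in \<open>auto simp: grassmannian_simps\<close>)
qed

text \<open>The curvature is only prescribed at the centres of the charts. A point \<open>Z\<close> is the centre of
  another chart, and the transition map \<open>\<tau>\<close> is an isometric immersion between domains of equal
  dimension; hence its second fundamental form vanishes and the Gauss equation for \<open>\<tau>\<close> says that
  curvature is invariant.\<close>

lemma grassmannian_metric_sectional_bounds:
  fixes g :: "(complex^('k + 2)^('k + 2), complex^2^'k::finite) metric_field"
  assumes g: "normalized_grassmannian_metric g" and U: "U \<in> special_unitary"
    and X: "g U Z X X = 1" and Y: "g U Z Y Y = 1" and XY: "g U Z X Y = 0"
  shows "- 1 \<le> g U Z (curvature (g U) Z X Y Y) X" "g U Z (curvature (g U) Z X Y Y) X \<le> 8"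
proof -
  let ?M = "grassmannian :: (_, complex^2^'k, _) manifold"
  obtain U' where U': "U' \<in> special_unitary" "par ?M U' 0 = par ?M U Z"
    by (rule grassmannian_centred_chart[OF U])
  define D where "D = rep_dom ?M ?M (\<lambda>p. p) U U'"
  define \<tau> where "\<tau> = rep ?M ?M (\<lambda>p. p) U U'"
  \<comment> \<open>Applied to the identity matrix, invariance says that the transition maps
    preserve the metric.\<close>
  have "mat 1 \<in> (special_unitary :: (complex^('k + 2)^('k + 2)) set)"
    by (auto simp: special_unitary_def conj_transpose_def mat_def vec_eq_iff matrix_matrix_mult_def
      if_distrib[of "\<lambda>z. z * _"] if_distrib[of cnj] det_I[unfolded mat_def] cong: if_cong)
  moreover have "((`) (\<lambda>v. (mat 1 :: complex^('k + 2)^('k + 2)) *v v)) = (\<lambda>p. p)"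
    by (simp add: fun_eq_iff)
  ultimately have "isometric_immersion ?M g ?M g (\<lambda>p. p)"
    using g unfolding normalized_grassmannian_metric_def by metis
  then have sm: "open D" "smooth_on D \<tau>"
    and iso: "\<And>x u v. x \<in> D \<Longrightarrow> g U x u v = g U' (\<tau> x) (dir_deriv \<tau> x u) (dir_deriv \<tau> x v)"
    using U U' unfolding isometric_immersion_def smooth_map_def preserves_metric_def D_def \<tau>_def
    by (auto simp: grassmannian_simps(1))
  interpret t: isometric_patch D "g U" UNIV "g U'" \<tau>
  proof (intro isometric_patch.intro isometric_patch_axioms.intro)
    show "riemannian_patch D (g U)"
      using riemannian_metric_patch[of ?M g U D] g U sm(1)
      by (simp add: normalized_grassmannian_metric_def grassmannian_simps)
    show "riemannian_patch UNIV (g U')" by (rule grassmannian_metric_patch[OF g U'(1)])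
  qed (use sm iso in auto)
  have ZD: "Z \<in> D"
    unfolding D_def rep_dom_def using U'(2) by (auto simp: grassmannian_simps(2) image_iff)
  have "inv_into UNIV (par ?M U') (par ?M U Z) = 0"
    using U' grassmannian_par_inj by (metis UNIV_I f_inv_into_f rangeI)
  then have \<tau>0: "\<tau> Z = 0" by (simp add: \<tau>_def rep_def grassmannian_simps(2))
  interpret q: inner_form "g U' 0" by (rule t.target.form) simp
  interpret p: inner_form "g U Z" by (rule t.source.form[OF ZD])
  note iso0 = iso[OF ZD, unfolded \<tau>0]
  have "inj (dir_deriv \<tau> Z)"
  proof (subst linear_injective_0[OF t.linear_d\<psi>[OF ZD]], intro allI impI)
    fix u assume "dir_deriv \<tau> Z u = 0"
    then have "g U Z u u = 0" by (simp add: iso0 q.form_simps)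
    then show "u = 0" by (simp add: p.eq_0_iff)
  qed
  then have surj: "surj (dir_deriv \<tau> Z)"
    using linear_injective_imp_surjective[OF t.linear_d\<psi>[OF ZD]] by blast
  \<comment> \<open>The differential is onto, so a normal vector is orthogonal to
    everything.\<close>
  have sff0: "t.sff Z u v = 0" for u v
  proof (rule q.eqI)
    fix w
    obtain w' where "w = dir_deriv \<tau> Z w'" using surj by (rule surjE)
    then show "g U' 0 (t.sff Z u v) w = g U' 0 0 w"
      using t.second_fundamental_form_normal[OF ZD, of u v w'] by (simp add: \<tau>0 q.form_simps)
  qed
  let ?X = "dir_deriv \<tau> Z X" and ?Y = "dir_deriv \<tau> Z Y"
  have "g U Z (curvature (g U) Z X Y Y) X = g U' 0 (curvature (g U') 0 ?X ?Y ?Y) ?X"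
    using t.gauss_equation[OF ZD, of X Y Y X] by (simp add: sff0 \<tau>0 q.form_simps)
  also have "\<dots> = g U' 0 (grassmannian_curvature (g U' 0) ?X ?Y ?Y) ?X"
    using g U' by (simp add: normalized_grassmannian_metric_def)
  finally have K: "g U Z (curvature (g U) Z X Y Y) X = \<dots>" .
  have H: "g U' 0 (cpx_J X) (cpx_J Y) = g U' 0 X Y"
    "\<alpha> \<in> {1..3} \<Longrightarrow> g U' 0 (quat_J \<alpha> X) (quat_J \<alpha> Y) = g U' 0 X Y" for X Y \<alpha>
    using g U' by (auto simp: normalized_grassmannian_metric_def)
  show "- 1 \<le> g U Z (curvature (g U) Z X Y Y) X" "g U Z (curvature (g U) Z X Y Y) X \<le> 8"
    unfolding K using grassmannian_sectional_bounds[OF q.inner_form_axioms H, of ?X ?Y] X Y XY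
    by (auto simp: iso0)
qed

section \<open>Warped products\<close>

text \<open>Projections replace the pattern matching of \<open>warped_metric\<close>, so that
  derivative rules apply to the point argument.\<close>

definition warped :: "'b local_metric \<Rightarrow> ('b \<Rightarrow> real) \<Rightarrow> 'f local_metric \<Rightarrow> ('b \<times> 'f) local_metric" where
  "warped gb \<phi> gf = (\<lambda>p u v. gb (fst p) (fst u) (fst v) + (\<phi> (fst p))\<^sup>2 * gf (snd p) (snd u) (snd v))"

lemma warped_metric_eq: "warped_metric B gB f gF (i, j) = warped (gB i) (\<lambda>x. f (par B i x)) (gF j)"
  by (auto simp: warped_metric_def warped_def fun_eq_iff)

locale warped_patch = base: riemannian_patch SB gb + fiber: riemannian_patch SF gf
  for SB :: "'b::euclidean_space set" and gb and SF :: "'f::euclidean_space set" and gf +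
  fixes \<phi> :: "'b \<Rightarrow> real"
  assumes smooth_\<phi>: "smooth_on SB \<phi>" and pos_\<phi>: "x \<in> SB \<Longrightarrow> \<phi> x > 0"
begin

abbreviation G :: "('b \<times> 'f) local_metric" where "G \<equiv> warped gb \<phi> gf"

lemma G_has_derivative:
  assumes p: "p \<in> SB \<times> SF"
  shows "((\<lambda>p. G p u v) has_derivative (\<lambda>w.
    dir_deriv (\<lambda>x. gb x (fst u) (fst v)) (fst p) (fst w) +
    (2 * \<phi> (fst p) * dir_deriv \<phi> (fst p) (fst w) * gf (snd p) (snd u) (snd v) +
     (\<phi> (fst p))\<^sup>2 * dir_deriv (\<lambda>y. gf y (snd u) (snd v)) (snd p) (snd w)))) (at p)"
proof -
  have b: "((\<lambda>p. gb (fst p) (fst u) (fst v)) has_derivative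
      (\<lambda>w. dir_deriv (\<lambda>x. gb x (fst u) (fst v)) (fst p) (fst w))) (at p)"
    by (rule has_derivative_compose[OF has_derivative_fst[OF has_derivative_ident]
      frechet_derivative_works[THEN iffD1, OF base.diff1]]) (use p in auto)
  have f: "((\<lambda>p. gf (snd p) (snd u) (snd v)) has_derivative
      (\<lambda>w. dir_deriv (\<lambda>y. gf y (snd u) (snd v)) (snd p) (snd w))) (at p)"
    by (rule has_derivative_compose[OF has_derivative_snd[OF has_derivative_ident]
      frechet_derivative_works[THEN iffD1, OF fiber.diff1]]) (use p in auto)
  have h: "((\<lambda>p. \<phi> (fst p)) has_derivative (\<lambda>w. dir_deriv \<phi> (fst p) (fst w))) (at p)"
    by (rule has_derivative_compose[OF has_derivative_fst[OF has_derivative_ident]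
      frechet_derivative_works[THEN iffD1, OF smooth_on_differentiable[OF smooth_\<phi>]]]) (use p in auto)
  show ?thesis
    unfolding warped_def
    by (rule has_derivative_eq_rhs[OF has_derivative_add[OF b has_derivative_mult[OF has_derivative_power[OF h] f]]])
      (auto simp: fun_eq_iff algebra_simps)
qed

lemmas dir_deriv_G = frechet_derivative_eqI[OF G_has_derivative]

lemma differentiable_fst_comp:
  "f differentiable (at (fst p)) \<Longrightarrow> (\<lambda>p. f (fst p)) differentiable (at p)"
  by (drule differentiable_chain_at[OF bounded_linear_imp_differentiable[OF bounded_linear_fst]])
    (simp add: o_def)

lemma differentiable_snd_comp:
  "f differentiable (at (snd p)) \<Longrightarrow> (\<lambda>p. f (snd p)) differentiable (at p)"
  by (drule differentiable_chain_at[OF bounded_linear_imp_differentiable[OF bounded_linear_snd]])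
    (simp add: o_def)

lemma inner_form_G:
  assumes p: "p \<in> SB \<times> SF" shows "inner_form (G p)"
proof -
  interpret b: inner_form "gb (fst p)" by (rule base.form) (use p in auto)
  interpret f: inner_form "gf (snd p)" by (rule fiber.form) (use p in auto)
  have \<phi>: "\<phi> (fst p) > 0" using p pos_\<phi> by auto
  show ?thesis
  proof
    show "bilinear (G p)"
      unfolding bilinear_def
      by (intro conjI allI linearI) (simp_all add: warped_def b.form_simps f.form_simps algebra_simps)
    show "G p u v = G p v u" for u v
      by (simp add: warped_def b.sym[of "fst u"] f.sym[of "snd u"])
    show "G p u u > 0" if "u \<noteq> 0" for u
    proof (cases "fst u = 0")
      case True
      then have "snd u \<noteq> 0" using that by (metis prod.collapse zero_prod_def)
      then show ?thesis using True f.pos \<phi> by (simp add: warped_def b.form_simps)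
    next
      case False
      then show ?thesis using b.pos f.nonneg by (simp add: warped_def add_pos_nonneg)
    qed
  qed
qed

sublocale total: riemannian_patch "SB \<times> SF" G
proof (rule riemannian_patch.intro)
  show "open (SB \<times> SF)" using base.open_S fiber.open_S by (rule open_Times)
  fix p assume p: "p \<in> SB \<times> SF"
  then have p': "fst p \<in> SB" "snd p \<in> SF" by auto
  show "inner_form (G p)" by (rule inner_form_G[OF p])
  show "(\<lambda>p. G p u v) differentiable (at p)" for u v
    using G_has_derivative[OF p] differentiable_def by blast
  show "(\<lambda>p. dir_deriv (\<lambda>p. G p u v) p w) differentiable (at p)" for u v w
  proof -
    let ?D = "\<lambda>p. dir_deriv (\<lambda>x. gb x (fst u) (fst v)) (fst p) (fst w) +
      (2 * \<phi> (fst p) * dir_deriv \<phi> (fst p) (fst w) * gf (snd p) (snd u) (snd v) +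
       (\<phi> (fst p))\<^sup>2 * dir_deriv (\<lambda>y. gf y (snd u) (snd v)) (snd p) (snd w))"
    have "(\<lambda>p. dir_deriv (\<lambda>x. gb x (fst u) (fst v)) (fst p) (fst w)) differentiable (at p)"
      by (rule differentiable_fst_comp[OF base.diff2[OF p'(1)]])
    moreover have "(\<lambda>p. dir_deriv (\<lambda>y. gf y (snd u) (snd v)) (snd p) (snd w)) differentiable (at p)"
      by (rule differentiable_snd_comp[OF fiber.diff2[OF p'(2)]])
    moreover have "(\<lambda>p. gf (snd p) (snd u) (snd v)) differentiable (at p)"
      by (rule differentiable_snd_comp[OF fiber.diff1[OF p'(2)]])
    moreover have "(\<lambda>p. \<phi> (fst p)) differentiable (at p)"
      by (rule differentiable_fst_comp[OF smooth_on_differentiable[OF smooth_\<phi> p'(1)]])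
    moreover have "(\<lambda>p. dir_deriv \<phi> (fst p) (fst w)) differentiable (at p)"
      by (rule differentiable_fst_comp[OF smooth_on_differentiable[OF smooth_on_dir_deriv[OF smooth_\<phi>] p'(1)]])
    ultimately have "?D differentiable (at p)"
      by (intro differentiable_add differentiable_mult differentiable_power differentiable_const)
    then obtain D' where "(?D has_derivative D') (at p)" by (auto simp: differentiable_def)
    then have "((\<lambda>p. dir_deriv (\<lambda>p. G p u v) p w) has_derivative D') (at p)"
      by (rule has_derivative_transform_within_open[OF _ open_Times[OF base.open_S fiber.open_S] p])
        (simp only: dir_deriv_G)
    then show ?thesis by (auto simp: differentiable_def)
  qed
qed

text \<open>The slices of the base are totally geodesic: in the Koszul formula for two base vectors
  the warping function is always multiplied by a vanishing fibre component.\<close>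

lemma christoffel_horizontal:
  assumes p: "p \<in> SB \<times> SF"
  shows "christoffel G p (u, 0) (v, 0) = (christoffel gb (fst p) u v, 0)"
proof (rule total.christoffel_eqI[OF p])
  have p': "fst p \<in> SB" "snd p \<in> SF" using p by auto
  fix w
  interpret f: inner_form "gf (snd p)" by (rule fiber.form[OF p'(2)])
  show "2 * G p (christoffel gb (fst p) u v, 0) w = koszul G p (u, 0) (v, 0) w"
    using base.christoffel_koszul[OF p'(1), of u v "fst w"] linear_0[OF fiber.linear_dir_deriv(1)[OF p'(2)]]
    unfolding koszul_def dir_deriv_G[OF p]
    by (simp add: warped_def f.form_simps linear_0[OF fiber.linear_dir_deriv(3)[OF p'(2)]])
qed

text \<open>Of the Koszul expression only the derivative of the squared warping function along
  \<open>u\<close> survives; dividing by that square leaves the logarithmic derivative of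
  \<open>\<phi>\<close>.\<close>

lemma christoffel_mixed:
  assumes p: "p \<in> SB \<times> SF"
  shows "christoffel G p (u, 0) (0, w) = (0, (dir_deriv \<phi> (fst p) u / \<phi> (fst p)) *\<^sub>R w)"
proof (rule total.christoffel_eqI[OF p])
  have p': "fst p \<in> SB" "snd p \<in> SF" using p by auto
  fix z
  interpret f: inner_form "gf (snd p)" by (rule fiber.form[OF p'(2)])
  interpret b: inner_form "gb (fst p)" by (rule base.form[OF p'(1)])
  show "2 * G p (0, (dir_deriv \<phi> (fst p) u / \<phi> (fst p)) *\<^sub>R w) z = koszul G p (u, 0) (0, w) z"
    using pos_\<phi>[OF p'(1)] linear_0[OF fiber.linear_dir_deriv(1)[OF p'(2)]]
      linear_0[OF fiber.linear_dir_deriv(2)[OF p'(2)]]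
      linear_0[OF base.linear_dir_deriv(1)[OF p'(1)]] linear_0[OF base.linear_dir_deriv(2)[OF p'(1)]]
    unfolding koszul_def dir_deriv_G[OF p]
    by (simp add: warped_def f.form_simps b.form_simps linear_0[OF fiber.linear_dir_deriv(3)[OF p'(2)]]
      linear_0[OF base.linear_dir_deriv(3)[OF p'(1)]] power2_eq_square
      linear_0[OF linear_frechet_derivative[OF smooth_on_differentiable[OF smooth_\<phi> p'(1)]]])
qed

text \<open>Minus the Hessian of \<open>\<phi>\<close> on the diagonal; the sign follows
  \<open>laplacian\<close>.\<close>

definition neg_hessian :: "'b \<Rightarrow> 'b \<Rightarrow> real" where
  "neg_hessian x v = dir_deriv \<phi> x (christoffel gb x v v) - dir_deriv (\<lambda>y. dir_deriv \<phi> y v) x v"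

text \<open>One covariant derivative gives \<open>\<phi>\<close> differentiated along the base
  vector \<open>christoffel gb x v v\<close>, over \<open>\<phi>\<close>. The other gives the
  derivative of \<open>dir_deriv \<phi> x v / \<phi> x\<close> along \<open>v\<close> plus the
  square of this quotient; the quotient rule subtracts the same square, so only the Hessian
  remains.\<close>

lemma curvature_mixed:
  assumes p: "p \<in> SB \<times> SF"
  shows "curvature G p (0, w) (v, 0) (v, 0) = (0, (neg_hessian (fst p) v / \<phi> (fst p)) *\<^sub>R w)"
proof -
  have p': "fst p \<in> SB" "snd p \<in> SF" using p by auto
  note op = open_Times[OF base.open_S fiber.open_S]
  have \<phi>: "\<phi> (fst p) > 0" by (rule pos_\<phi>[OF p'(1)])
  have d1: "((\<lambda>q. christoffel G q (v, 0) (v, 0)) has_derivative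
      (\<lambda>u. (dir_deriv (\<lambda>x. christoffel gb x v v) (fst p) (fst u), 0))) (at p)"
  proof (rule has_derivative_transform_within_open[OF _ op p])
    show "((\<lambda>q. (christoffel gb (fst q) v v, 0)) has_derivative
      (\<lambda>u. (dir_deriv (\<lambda>x. christoffel gb x v v) (fst p) (fst u), 0))) (at p)"
      by (intro has_derivative_Pair has_derivative_const
        has_derivative_compose[OF has_derivative_fst[OF has_derivative_ident]
          frechet_derivative_works[THEN iffD1, OF base.christoffel_differentiable[OF p'(1)]]])
  qed (simp add: christoffel_horizontal)
  have d2: "((\<lambda>q. christoffel G q (0, w) (v, 0)) has_derivative
      (\<lambda>u. (0, ((dir_deriv (\<lambda>x. dir_deriv \<phi> x v) (fst p) (fst u) * \<phi> (fst p) -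
        dir_deriv \<phi> (fst p) v * dir_deriv \<phi> (fst p) (fst u)) / (\<phi> (fst p) * \<phi> (fst p))) *\<^sub>R w))) (at p)"
  proof (rule has_derivative_transform_within_open[OF _ op p])
    have "((\<lambda>x. dir_deriv \<phi> x v / \<phi> x) has_derivative
        (\<lambda>u. (dir_deriv (\<lambda>x. dir_deriv \<phi> x v) (fst p) u * \<phi> (fst p) -
        dir_deriv \<phi> (fst p) v * dir_deriv \<phi> (fst p) u) / (\<phi> (fst p) * \<phi> (fst p)))) (at (fst p))"
      by (rule has_derivative_divide'[OF
        frechet_derivative_works[THEN iffD1, OF smooth_on_differentiable[OF smooth_on_dir_deriv[OF smooth_\<phi>] p'(1)]]
        frechet_derivative_works[THEN iffD1, OF smooth_on_differentiable[OF smooth_\<phi> p'(1)]]])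
        (use \<phi> in simp)
    from has_derivative_compose[OF has_derivative_fst[OF has_derivative_ident] this]
    show "((\<lambda>q. (0, (dir_deriv \<phi> (fst q) v / \<phi> (fst q)) *\<^sub>R w)) has_derivative
      (\<lambda>u. (0, ((dir_deriv (\<lambda>x. dir_deriv \<phi> x v) (fst p) (fst u) * \<phi> (fst p) -
        dir_deriv \<phi> (fst p) v * dir_deriv \<phi> (fst p) (fst u)) / (\<phi> (fst p) * \<phi> (fst p))) *\<^sub>R w))) (at p)"
      by (intro has_derivative_Pair has_derivative_const has_derivative_scaleR_left)
  qed (simp add: christoffel_mixed total.christoffel_sym[of _ "(0, w)"])
  have [simp]: "dir_deriv (\<lambda>x. christoffel gb x v v) (fst p) 0 = 0"
    by (rule linear_0[OF linear_frechet_derivative[OF base.christoffel_differentiable[OF p'(1)]]])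
  show ?thesis
    unfolding curvature_def total.covariant_derivative_const
    unfolding covariant_derivative_def frechet_derivative_eqI[OF d1] frechet_derivative_eqI[OF d2]
    using \<phi> by (simp add: christoffel_horizontal[OF p] christoffel_mixed[OF p]
        total.christoffel_sym[OF p, of "(0, w)"] neg_hessian_def scaleR_diff_left[symmetric]
        scaleR_add_left[symmetric] power2_eq_square diff_divide_distrib)
qed

text \<open>The derivative of the components of the frame occurs in both terms of the Laplacian and
  cancels, so only the values of \<open>V\<close> at \<open>x\<close> matter.\<close>

lemma laplacian_neg_hessian:
  assumes x: "x \<in> W" and W: "W \<subseteq> SB" and V: "local_orthonormal_frame gb W V"
  shows "laplacian gb V \<phi> x = (\<Sum>b\<in>Basis. neg_hessian x (V b x))"
  unfolding laplacian_def
proof (intro sum.cong refl)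
  fix b :: 'b assume b: "b \<in> Basis"
  have xS: "x \<in> SB" using x W by blast
  have op: "open W" and Vb: "smooth_on W (V b)"
    using V b by (auto simp: local_orthonormal_frame_def)
  have lin: "linear (dir_deriv \<phi> y)" if "y \<in> SB" for y
    by (rule linear_frechet_derivative[OF smooth_on_differentiable[OF smooth_\<phi> that]])
  have "((\<lambda>y. dir_deriv \<phi> y (V b y)) has_derivative
      (\<lambda>u. dir_deriv (\<lambda>y. dir_deriv \<phi> y (V b x)) x u + dir_deriv \<phi> x (dir_deriv (V b) x u))) (at x)"
    by (rule has_derivative_linear_field[OF lin base.open_S xS
      frechet_derivative_works[THEN iffD1, OF smooth_on_differentiable[OF smooth_on_dir_deriv[OF smooth_\<phi>] xS]]
      frechet_derivative_works[THEN iffD1, OF smooth_on_differentiable[OF Vb x]]]) auto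
  then show "dir_deriv \<phi> x (covariant_derivative gb x (V b x) (V b)) -
      dir_deriv (\<lambda>y. dir_deriv \<phi> y (V b y)) x (V b x) = neg_hessian x (V b x)"
    by (simp add: frechet_derivative_eqI neg_hessian_def covariant_derivative_def linear_add[OF lin[OF xS]])
qed

end

section \<open>The immersed warped product\<close>

lemma sum_Basis_prod:
  fixes f :: "'a::euclidean_space \<times> 'b::euclidean_space \<Rightarrow> 'c::comm_monoid_add"
  shows "sum f Basis = (\<Sum>i\<in>Basis. f (i, 0)) + (\<Sum>i\<in>Basis. f (0, i))"
proof -
  have "inj_on (\<lambda>u. (u::'a, 0::'b)) Basis" "inj_on (\<lambda>u. (0::'a, u::'b)) Basis"
    by (auto intro!: inj_onI)
  then show ?thesis
    unfolding Basis_prod_def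
    by (subst sum.union_disjoint) (auto simp: sum.reindex)
qed

text \<open>Linearity in the second argument is seen after exchanging the two differentiations of
  \<open>\<psi>\<close>; symmetry then gives the first argument.\<close>

lemma second_fundamental_form_bilinear:
  assumes "isometric_patch S G T H \<psi>" and x: "x \<in> S"
  shows "bilinear (second_fundamental_form G H \<psi> x)"
proof -
  interpret isometric_patch S G T H \<psi> by (rule assms)
  have C: "linear (christoffel H (\<psi> x) w)" "linear (christoffel G x u)" for u w
    using target.christoffel_bilinear[OF target_point[OF x]] source.christoffel_bilinear[OF x]
    by (auto simp: bilinear_def)
  have r: "linear (sff x u)" for u
  proof -
    have D: "linear (\<lambda>v. dir_deriv (d\<psi> v) x u)"
    proof -
      have "linear (\<lambda>v. dir_deriv (d\<psi> u) x v)" by (rule linear_frechet_derivative[OF diff_d\<psi>[OF x]])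
      then show ?thesis using dir_deriv_commute[OF source.open_S x smooth, of u] by simp
    qed
    show ?thesis
      unfolding second_fundamental_form_eq along_d\<psi>
      by (intro linear_compose_sub linear_compose_add D linear_compose[OF linear_d\<psi>[OF x] C(1), unfolded o_def]
        linear_compose[OF C(2) linear_d\<psi>[OF x], unfolded o_def])
  qed
  moreover have "linear (\<lambda>u. sff x u v)" for v
  proof -
    have "(\<lambda>u. sff x u v) = sff x v" by (rule ext) (rule second_fundamental_form_sym[OF x])
    then show ?thesis using r[of v] by simp
  qed
  ultimately show ?thesis by (simp add: bilinear_def)
qed

theorem theorem4p1:
  fixes B :: "('i, 'b::euclidean_space, 'p) manifold" and gB :: "('i, 'b) metric_field"
    and F :: "('j, 'f::euclidean_space, 'q) manifold" and gF :: "('j, 'f) metric_field"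
    and f :: "'p \<Rightarrow> real"
    and gbar :: "(complex^('k + 2)^('k + 2), complex^2^'k::finite) metric_field"
    and \<psi> :: "'p \<times> 'q \<Rightarrow> (complex^('k + 2)) set"
  assumes B: "smooth_manifold B" "riemannian_metric B gB"
    and F: "smooth_manifold F" "riemannian_metric F gF"
    and f: "smooth_fun B f" "\<And>p. p \<in> carrier B \<Longrightarrow> f p > 0"
    and gbar: "normalized_grassmannian_metric gbar"
    and \<psi>: "isometric_immersion (product_manifold B F) (warped_metric B gB f gF) grassmannian gbar \<psi>"
    \<comment> \<open>an arbitrary point of \<open>M\<close>, in arbitrary charts of \<open>B\<close>, \<open>F\<close> and the Grassmannian\<close>
    and charts: "i \<in> indices B" "j \<in> indices F" "U \<in> indices grassmannian"
    and xy: "(x, y) \<in> rep_dom (product_manifold B F) grassmannian \<psi> (i, j) U"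
    \<comment> \<open>an arbitrary local orthonormal frame of \<open>B\<close> and an orthonormal basis of the tangent space of \<open>M\<close>\<close>
    and V: "x \<in> W" "W \<subseteq> dom B i" "local_orthonormal_frame (gB i) W V"
    and e: "orthonormal_at (warped_metric B gB f gF (i, j)) (x, y) e"
  shows "let
       m1 = real DIM('b); m2 = real DIM('f); m = m1 + m2;
       \<psi>c = rep (product_manifold B F) grassmannian \<psi> (i, j) U;
       q = gbar U (\<psi>c (x, y));
       h = second_fundamental_form (warped_metric B gB f gF (i, j)) (gbar U) \<psi>c (x, y);
       H = mean_curvature_vector h e;
       lap_f = laplacian (gB i) V (\<lambda>z. f (par B i z)) x
     in
       m1 * m\<^sup>2 / (2 * (m - 1)) * q H H - m1 / 2 * sff_norm_sq q h e - m1
         \<le> lap_f / f (par B i x) \<and>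
       lap_f / f (par B i x) \<le> m\<^sup>2 / (4 * m2) * q H H + 8 * m1"
proof -
  define SB where "SB = dom B i"
  define SF where "SF = dom F j"
  define \<phi> where "\<phi> = (\<lambda>z. f (par B i z))"
  define G where "G = warped_metric B gB f gF (i, j)"
  define \<psi>c where "\<psi>c = rep (product_manifold B F) grassmannian \<psi> (i, j) U"
  define S where "S = rep_dom (product_manifold B F) grassmannian \<psi> (i, j) U"
  define q where "q = gbar U (\<psi>c (x, y))"
  define h where "h = second_fundamental_form G (gbar U) \<psi>c (x, y)"
  define m1 where "m1 = real DIM('b)"
  define m2 where "m2 = real DIM('f)"
  define L where "L = laplacian (gB i) V \<phi> x / \<phi> x"
  have U: "U \<in> special_unitary" using charts(3) by (simp add: grassmannian_simps)
  have G_eq: "G = warped (gB i) \<phi> (gF j)" unfolding G_def warped_metric_eq \<phi>_def ..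
  have "riemannian_patch SB (gB i)" "riemannian_patch SF (gF j)"
    using B F charts by (auto simp: SB_def SF_def smooth_manifold_def intro!: riemannian_metric_patch)
  then interpret w: warped_patch SB "gB i" SF "gF j" \<phi>
    using f charts(1)
    by (intro warped_patch.intro warped_patch_axioms.intro)
      (auto simp: SB_def \<phi>_def smooth_fun_def carrier_def)
  have ij: "(i, j) \<in> indices (product_manifold B F)" using charts by (simp add: product_manifold_def)
  have S: "open S" "smooth_on S \<psi>c" and iso: "\<And>p u v. p \<in> S \<Longrightarrow>
      G p u v = gbar U (\<psi>c p) (dir_deriv \<psi>c p u) (dir_deriv \<psi>c p v)"
    using \<psi>[unfolded isometric_immersion_def, THEN conjunct1, unfolded smooth_map_def, THEN conjunct2,
        rule_format, OF ij charts(3)]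
      \<psi>[unfolded isometric_immersion_def, THEN conjunct2, unfolded preserves_metric_def,
        rule_format, OF ij charts(3)]
    by (simp_all add: S_def \<psi>c_def G_def)
  have S_sub: "S \<subseteq> SB \<times> SF"
    by (auto simp: S_def rep_dom_def product_manifold_def SB_def SF_def)
  interpret t: isometric_patch S G UNIV "gbar U" \<psi>c
  proof (intro isometric_patch.intro isometric_patch_axioms.intro)
    show "riemannian_patch S G"
      using S S_sub w.total.form w.total.diff1 w.total.diff2
      unfolding G_eq by (intro riemannian_patch.intro) blast+
    show "riemannian_patch UNIV (gbar U)" by (rule grassmannian_metric_patch[OF gbar U])
  qed (use S iso in auto)
  have p: "(x, y) \<in> S" using xy by (simp add: S_def)
  have p': "x \<in> SB" "y \<in> SF" using p S_sub by auto
  have \<phi>: "\<phi> x > 0" by (rule w.pos_\<phi>[OF p'(1)])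
  interpret q: inner_form q unfolding q_def by (rule t.target.form) simp
  interpret g: inner_form "G (x, y)" by (rule t.source.form[OF p])
  interpret fy: inner_form "gF j y" by (rule w.fiber.form[OF p'(2)])
  \<comment> \<open>The fibre part of the warped metric at the point. A basis orthonormal for this
    form completes the base frame to an orthonormal frame of the product.\<close>
  interpret v: inner_form "\<lambda>w w'. (\<phi> x)\<^sup>2 * gF j y w w'"
  proof
    show "bilinear (\<lambda>w w'. (\<phi> x)\<^sup>2 * gF j y w w')"
      unfolding bilinear_def by (intro conjI allI linearI) (simp_all add: fy.form_simps algebra_simps)
    show "(\<phi> x)\<^sup>2 * gF j y w w' = (\<phi> x)\<^sup>2 * gF j y w' w" for w w' by (simp add: fy.sym[of w])
    show "(\<phi> x)\<^sup>2 * gF j y w w > 0" if "w \<noteq> 0" for w using fy.pos[OF that] \<phi> by simp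
  qed
  interpret bx: inner_form "gB i x" by (rule w.base.form[OF p'(1)])
  obtain \<omega> where \<omega>: "v.orthonormal \<omega>" using v.exists_orthonormal by blast
  have Vx: "gB i x (V a x) (V b x) = (if a = b then 1 else 0)" if "a \<in> Basis" "b \<in> Basis" for a b
    using V that by (auto simp: local_orthonormal_frame_def orthonormal_at_def)
  have \<omega>': "(\<phi> x)\<^sup>2 * gF j y (\<omega> a) (\<omega> b) = (if a = b then 1 else 0)" if "a \<in> Basis" "b \<in> Basis" for a b
    using \<omega> that by blast
  \<comment> \<open>The basis of the product consists of the pairs \<open>(b, 0)\<close> and
    \<open>(0, c)\<close>; since basis vectors are nonzero, the test on \<open>snd a\<close> tells
    them apart.\<close>
  define E where "E a = (if snd a = 0 then (V (fst a) x, 0) else (0, \<omega> (snd a)))" for a :: "'b \<times> 'f"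
  have EB: "E (b, 0) = (V b x, 0)" for b by (simp add: E_def)
  have EF: "c \<in> Basis \<Longrightarrow> E (0, c) = (0, \<omega> c)" for c by (auto simp: E_def)
  have E: "g.orthonormal E"
    unfolding G_eq
    by (auto simp: Basis_prod_def EB EF warped_def fy.form_simps bx.form_simps Vx \<omega>' split: if_splits)
  have e': "g.orthonormal e" using e by (simp add: orthonormal_at_def G_def)
  have h_bil: "bilinear h"
    unfolding h_def by (rule second_fundamental_form_bilinear[OF t.isometric_patch_axioms p])
  have h_sym: "h a b = h b a" for a b unfolding h_def by (rule t.second_fundamental_form_sym[OF p])
  have h_lin: "linear (h a)" "linear (\<lambda>a. h a b)" for a b using h_bil unfolding bilinear_def by blast+
  define P where "P a b = h (E a) (E b)" for a b
  define T where "T = (\<Sum>a\<in>Basis. P a a)"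
  define N where "N = (\<Sum>a\<in>Basis. \<Sum>b\<in>Basis. q (P a b) (P a b))"
  have T_eq: "(\<Sum>a\<in>Basis. h (e a) (e a)) = T"
    unfolding T_def P_def by (rule g.trace_orthonormal[OF e' E h_bil])
  have bil_right: "bilinear (\<lambda>u v. q (h w u) (h w v))" for w
    unfolding bilinear_def
    by (intro conjI allI linearI)
      (simp_all add: q.form_simps linear_add[OF h_lin(1)] linear_scale[OF h_lin(1)])
  have bil_left: "bilinear (\<lambda>u v. q (h u w) (h v w))" for w
    using bil_right[of w] by (simp add: h_sym[of _ w])
  \<comment> \<open>The frame is exchanged in one index at a time, each inner sum being the trace of
    a bilinear form.\<close>
  have N_eq: "sff_norm_sq q h e = N"
  proof -
    have "sff_norm_sq q h e = (\<Sum>a\<in>Basis. \<Sum>b\<in>Basis. q (h (e a) (E b)) (h (e a) (E b)))"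
      unfolding sff_norm_sq_def by (intro sum.cong refl g.trace_orthonormal[OF e' E bil_right])
    also have "\<dots> = (\<Sum>b\<in>Basis. \<Sum>a\<in>Basis. q (h (e a) (E b)) (h (e a) (E b)))" by (rule sum.swap)
    also have "\<dots> = (\<Sum>b\<in>Basis. \<Sum>a\<in>Basis. q (h (E a) (E b)) (h (E a) (E b)))"
      by (intro sum.cong[OF refl] g.trace_orthonormal[OF e' E bil_left])
    also have "\<dots> = N" unfolding N_def P_def by (rule sum.swap)
    finally show ?thesis .
  qed
  define H where "H = mean_curvature_vector h e"
  \<comment> \<open>Both dimensions are positive, so \<open>m2\<close> and
    \<open>m1 + m2 - 1\<close> may be divided by.\<close>
  have m: "m1 \<ge> 1" "m2 \<ge> 1" "real DIM('b \<times> 'f) = m1 + m2"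
    by (simp_all add: m1_def m2_def Suc_le_eq)
  have "T = (m1 + m2) *\<^sub>R H"
    unfolding H_def mean_curvature_vector_def T_eq m(3) using m by simp
  then have qT: "q T T = (m1 + m2)\<^sup>2 * q H H"
    by (simp add: q.form_simps power2_eq_square)
  define k where "k b = w.neg_hessian x (V b x) / \<phi> x" for b
  have L_eq: "L = (\<Sum>b\<in>Basis. k b)"
    unfolding L_def k_def using V by (subst w.laplacian_neg_hessian[of x W]) (auto simp: SB_def sum_divide_distrib)
  \<comment> \<open>\<open>k b\<close> does not depend on \<open>c\<close>: every fibre direction
    gives the same curvature with a fixed base direction, so the bounds may be summed over
    \<open>c\<close> or used for one \<open>c\<close>.\<close>
  have k_bounds: "- 1 + (q (P (b, 0) (b, 0)) (P (0, c) (0, c)) - q (P (b, 0) (0, c)) (P (b, 0) (0, c))) \<le> k b"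
    "k b \<le> 8 + (q (P (b, 0) (b, 0)) (P (0, c) (0, c)) - q (P (b, 0) (0, c)) (P (b, 0) (0, c)))"
    if b: "b \<in> Basis" and c: "c \<in> Basis" for b c
  proof -
    have bc: "(b, 0::'f) \<in> Basis" "(0::'b, c) \<in> Basis" using b c by (auto simp: Basis_prod_def)
    let ?X = "dir_deriv \<psi>c (x, y) (E (0, c))" and ?Y = "dir_deriv \<psi>c (x, y) (E (b, 0))"
    have XY: "q ?X ?X = 1" "q ?Y ?Y = 1" "q ?X ?Y = 0"
      unfolding q_def iso[OF p, symmetric] using E bc c by auto
    have "k b = G (x, y) (curvature G (x, y) (E (0, c)) (E (b, 0)) (E (b, 0))) (E (0, c))"
    proof -
      have "curvature G (x, y) (E (0, c)) (E (b, 0)) (E (b, 0)) = k b *\<^sub>R E (0, c)"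
        unfolding G_eq EB EF[OF c] using w.curvature_mixed[of "(x, y)"] p' by (simp add: k_def)
      then show ?thesis using E bc by (simp add: g.form_simps)
    qed
    also have "\<dots> = q (curvature (gbar U) (\<psi>c (x, y)) ?X ?Y ?Y) ?X +
        (q (P (b, 0) (b, 0)) (P (0, c) (0, c)) - q (P (b, 0) (0, c)) (P (b, 0) (0, c)))"
      using t.gauss_equation[OF p, of "E (0, c)" "E (b, 0)" "E (b, 0)" "E (0, c)"]
        h_sym[of "E (0, c)" "E (b, 0)"]
      by (simp add: q_def[symmetric] h_def[symmetric] P_def)
    finally have K: "k b = \<dots>" .
    note bounds = grassmannian_metric_sectional_bounds[OF gbar U XY[unfolded q_def], folded q_def]
    show "- 1 + (q (P (b, 0) (b, 0)) (P (0, c) (0, c)) - q (P (b, 0) (0, c)) (P (b, 0) (0, c))) \<le> k b"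
      "k b \<le> 8 + (q (P (b, 0) (b, 0)) (P (0, c) (0, c)) - q (P (b, 0) (0, c)) (P (b, 0) (0, c)))"
      using K bounds by simp_all
  qed
  have T_split: "T = (\<Sum>b\<in>Basis. P (b, 0) (b, 0)) + (\<Sum>c\<in>Basis. P (0, c) (0, c))"
    unfolding T_def by (rule sum_Basis_prod)
  have upper: "L \<le> (m1 + m2)\<^sup>2 / (4 * m2) * q H H + 8 * m1"
  proof -
    \<comment> \<open>Summing over \<open>c\<close> as well counts \<open>L\<close> once per fibre
      direction and brings in all mixed pairs at once.\<close>
    have "m2 * L = (\<Sum>b\<in>Basis. \<Sum>c\<in>(Basis :: 'f set). k b)"
      by (simp add: L_eq m2_def sum_distrib_left)
    also have "\<dots> \<le> (\<Sum>b\<in>Basis. \<Sum>c\<in>Basis. 8 + (q (P (b, 0) (b, 0)) (P (0, c) (0, c)) - q (P (b, 0) (0, c)) (P (b, 0) (0, c))))"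
      by (intro sum_mono k_bounds)
    also have "\<dots> = 8 * m1 * m2 + (\<Sum>b\<in>Basis. \<Sum>c\<in>Basis. q (P (b, 0) (b, 0)) (P (0, c) (0, c)) - q (P (b, 0) (0, c)) (P (b, 0) (0, c)))"
      by (simp add: sum.distrib m1_def m2_def)
    also have "(\<Sum>b\<in>Basis. \<Sum>c\<in>Basis. q (P (b, 0) (b, 0)) (P (0, c) (0, c)) - q (P (b, 0) (0, c)) (P (b, 0) (0, c))) \<le> q T T / 4"
      using q.chen_upper[where p = P and I = "(\<lambda>b. (b, 0)) ` Basis" and K = "(\<lambda>c. (0, c)) ` Basis"]
      unfolding T_split by (simp add: sum.reindex inj_on_def)
    finally have "m2 * L \<le> 8 * m1 * m2 + (m1 + m2)\<^sup>2 * q H H / 4" unfolding qT by simp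
    then have "L \<le> (8 * m1 * m2 + (m1 + m2)\<^sup>2 * q H H / 4) / m2"
      using m by (simp add: pos_le_divide_eq mult.commute)
    also have "\<dots> = (m1 + m2)\<^sup>2 / (4 * m2) * q H H + 8 * m1"
      using m by (simp add: field_simps)
    finally show ?thesis .
  qed
  have lower: "m1 * (m1 + m2)\<^sup>2 / (2 * (m1 + m2 - 1)) * q H H - m1 / 2 * N - m1 \<le> L"
  proof -
    obtain c :: 'f where c: "c \<in> Basis" using nonempty_Basis by blast
    \<comment> \<open>The bound is the same for every \<open>b\<close>, so that the sum over the
      base frame only contributes the factor \<open>m1\<close>.\<close>
    have "(q T T / (m1 + m2 - 1) - N) / 2 - 1 \<le> k b" if b: "b \<in> Basis" for b
    proof -
      have bc: "(b, 0::'f) \<in> Basis" "(0::'b, c) \<in> Basis" "(b, 0) \<noteq> (0, c)"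
        using b c by (auto simp: Basis_prod_def)
      have "(q T T / (m1 + m2 - 1) - N) / 2 \<le>
          q (P (b, 0) (b, 0)) (P (0, c) (0, c)) - q (P (b, 0) (0, c)) (P (b, 0) (0, c))"
        using q.chen_lower[OF finite_Basis bc, of P] h_sym unfolding T_def N_def m(3)[symmetric] P_def
        by blast
      then show ?thesis using k_bounds(1)[OF b c] by linarith
    qed
    then have "(\<Sum>b\<in>(Basis :: 'b set). (q T T / (m1 + m2 - 1) - N) / 2 - 1) \<le> L"
      unfolding L_eq by (rule sum_mono)
    then have "m1 * ((q T T / (m1 + m2 - 1) - N) / 2 - 1) \<le> L" by (simp add: m1_def)
    moreover have "m1 * ((q T T / (m1 + m2 - 1) - N) / 2 - 1) =
        m1 * (m1 + m2)\<^sup>2 / (2 * (m1 + m2 - 1)) * q H H - m1 / 2 * N - m1"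
      using m unfolding qT by (simp add: field_simps)
    ultimately show ?thesis by simp
  qed
  show ?thesis
    unfolding Let_def
    using lower upper
    unfolding L_def \<phi>_def N_eq[symmetric] H_def h_def q_def \<psi>c_def G_def m1_def m2_def by blast
qed

end
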